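(* Let $R:(\mathcal C\times\mathcal C)^{op}\to\mathbf{Pos}$ be an extensional relational doctrine with quotients. Then the following are equivalent: (1) Every $R$-surjective arrow in $\mathcal C$ splits. (2) For every monad $\mathbb T=(T,\eta,\mu)$ on $R$ in $\mathbf{RD}$, $R^{\mathbb T}$ is a balanced and extensional relational doctrine with quotients and $\mathcal C_{\widehat{\mathbb T}}$ is an $R^{\mathbb T}$-projective cover.
   Context: $\mathbf{Pos}$ is the category of posets and monotone maps. A relational doctrine consists of a category $\mathcal C$ (its base); a functor $R:(\mathcal C\times\mathcal C)^{op}\to\mathbf{Pos}$ (for $f:X\to A$, $g:Y\to B$ write $R_{f,g}:R(A,B)\to R(X,Y)$); elements $d_X\in R(X,X)$ with $d_X\le R_{f,f}(d_Y)$ for all $f:X\to Y$; monotone maps $;:R(X,Y)\times R(Y,Z)\to R(X,Z)$ with $R_{f,g}(\alpha);R_{g,h}(\beta)\le R_{f,h}(\alpha;\beta)$; monotone maps $(-)^\bot:R(X,Y)\to R(Y,X)$ with $(R_{f,g}(\alpha))^\bot\le R_{g,f}(\alpha^\bot)$; such that $;$ is associative with units $d$, $(\alpha;\beta)^\bot=\beta^\bot;\alpha^\bot$, $d_X^\bot=d_X$, $\alpha^{\bot\bot}=\alpha$. The graph of $f:X\to Y$ is $\Gamma_f=R_{f,\mathrm{id}_Y}(d_Y)\in R(X,Y)$. The arrow $f$ is $R$-surjective if $d_Y\le\Gamma_f^\bot;\Gamma_f$, injective if $\Gamma_f;\Gamma_f^\bot\le d_X$, bijective if both. An arrow $f$ splits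 if it has a section ($s$ with $f\circ s=\mathrm{id}$). $R$ is balanced if every bijective arrow in its base is an isomorphism. $R$ is extensional if, for parallel $f,g:X\to Y$, $d_X\le R_{f,g}(d_Y)$ implies $f=g$. An $R$-equivalence relation on $X$ is $\rho\in R(X,X)$ with $d_X\le\rho$, $\rho^\bot\le\rho$, $\rho;\rho\le\rho$. A quotient arrow of $\rho$ is $q:X\to W$ with $\rho\le\Gamma_q;\Gamma_q^\bot$ such that for every $f:X\to Z$ with $\rho\le\Gamma_f;\Gamma_f^\bot$ there is a unique $h:W\to Z$ with $f=h\circ q$. It is effective if $\rho=\Gamma_q;\Gamma_q^\bot$, and descent if $d_W\le\Gamma_q^\bot;\Gamma_q$. $R$ has quotients if every $R$-equivalence relation admits an effective descent quotient arrow. "A quotient arrow" means a quotient arrow of some $R$-equivalence relation. The 2-category $\mathbf{RD}$: objects are relational doctrines; a 1-arrow $F:R\to S$ (bases $\mathcal C,\mathcal D$) is a pair of a functor $\widehat F:\mathcal C\to\mathcal D$ and a natural transformation with components $\overline F_{X,Y}:R(X,Y)\to S(\widehat FX,\widehat FY)$ strictly preserving $d$, $;$ and $(-)^\bot$; a 2-arrow $\theta:F\Rightarrow G$ is a natural transformation $\theta:\widehat F\to\widehat G$ with $\overline F_{X,Y}(\alpha)\le S_{\theta_X,\theta_Y}(\overline G_{X,Y}(\alpha))$. A monad on $R$ in $\mathbf{RD}$ is a 1-arrow $T:R\to R$ with 2-arrows $\eta:\mathrm{Id}\Rightarrow T$, $\mu:T\circ T\Rightarrow T$ satisfying the usual monad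 laws; then $\widehat{\mathbb T}=(\widehat T,\eta,\mu)$ is a monad on $\mathcal C$. The Eilenberg–Moore doctrine $R^{\mathbb T}$ has as base the Eilenberg–Moore category $\mathcal C^{\widehat{\mathbb T}}$, and $R^{\mathbb T}((X,a),(Y,b))=\{\alpha\in R(X,Y)\mid\Gamma_a^\bot;\overline T_{X,Y}(\alpha);\Gamma_b\le\alpha\}$, with reindexing and relational operations as in $R$. $\mathcal C_{\widehat{\mathbb T}}$ is the full subcategory of $\mathcal C^{\widehat{\mathbb T}}$ on the free algebras $(\widehat TX,\mu_X)$, $X$ in $\mathcal C$. For $R$ with quotients, an object $P$ of the base is $R$-projective if for every arrow $f:P\to Y$ and every quotient arrow $q:X\to Y$ there is an arrow $h:P\to X$ with $f=q\circ h$. An $R$-projective cover is a full subcategory $\mathcal G$ of the base, all of whose objects are $R$-projective, such that for every object $X$ of the base there is a quotient arrow $q:P\to X$ with $P$ in $\mathcal G$. *)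

theory Defs
  imports Main
begin

text \<open>
  A category is given by hom-sets indexed by domain and codomain. Hom-sets of different pairs
  of objects (and likewise the fibres of a doctrine below) need not be disjoint, so every
  operation takes the objects involved as explicit arguments: \<open>Comp C X Y Z g f\<close> is
  \<open>g \<circ> f\<close> for \<open>f : X \<rightarrow> Y\<close> and \<open>g : Y \<rightarrow> Z\<close>.
\<close>

record ('o, 'a) cat =
  Obj :: "'o set"
  Hom :: "'o \<Rightarrow> 'o \<Rightarrow> 'a set"
  Ident :: "'o \<Rightarrow> 'a"
  Comp :: "'o \<Rightarrow> 'o \<Rightarrow> 'o \<Rightarrow> 'a \<Rightarrow> 'a \<Rightarrow> 'a"

abbreviation is_arrow :: "('o, 'a) cat \<Rightarrow> 'o \<Rightarrow> 'o \<Rightarrow> 'a \<Rightarrow> bool" where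
  "is_arrow C X Y f \<equiv> X \<in> Obj C \<and> Y \<in> Obj C \<and> f \<in> Hom C X Y"

locale category =
  fixes C :: "('o, 'a) cat"
  assumes ident_arrow: "X \<in> Obj C \<Longrightarrow> Ident C X \<in> Hom C X X"
    and comp_arrow: "\<lbrakk>is_arrow C X Y f; is_arrow C Y Z g\<rbrakk> \<Longrightarrow> Comp C X Y Z g f \<in> Hom C X Z"
    and comp_ident_right: "is_arrow C X Y f \<Longrightarrow> Comp C X X Y f (Ident C X) = f"
    and comp_ident_left: "is_arrow C X Y f \<Longrightarrow> Comp C X Y Y (Ident C Y) f = f"
    and comp_assoc:
      "\<lbrakk>is_arrow C W X f; is_arrow C X Y g; is_arrow C Y Z h\<rbrakk> \<Longrightarrow>
        Comp C W Y Z h (Comp C W X Y g f) = Comp C W X Z (Comp C X Y Z h g) f"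

definition splits :: "('o, 'a) cat \<Rightarrow> 'o \<Rightarrow> 'o \<Rightarrow> 'a \<Rightarrow> bool" where
  "splits C X Y f \<longleftrightarrow> (\<exists>s \<in> Hom C Y X. Comp C Y X Y f s = Ident C Y)"

definition is_iso :: "('o, 'a) cat \<Rightarrow> 'o \<Rightarrow> 'o \<Rightarrow> 'a \<Rightarrow> bool" where
  "is_iso C X Y f \<longleftrightarrow>
    (\<exists>g \<in> Hom C Y X. Comp C X Y X g f = Ident C X \<and> Comp C Y X Y f g = Ident C Y)"


text \<open>
  \<open>Fib R X Y\<close> with the order \<open>le R X Y\<close> is the poset \<open>R(X, Y)\<close>. For \<open>f : X \<rightarrow> A\<close> and
  \<open>g : Y \<rightarrow> B\<close>, the map \<open>R\<^bsub>f,g\<^esub> : R(A, B) \<rightarrow> R(X, Y)\<close> is \<open>reindex R X A Y B f g\<close>.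
  \<open>rident\<close>, \<open>rcomp\<close>, \<open>rconv\<close> are \<open>d\<close>, \<open>;\<close>, \<open>(-)\<^sup>\<bottom>\<close>; unlike \<open>Comp\<close>, \<open>rcomp\<close> takes its
  arguments in diagrammatic order.
\<close>

record ('o, 'a, 'r) doctrine =
  base :: "('o, 'a) cat"
  Fib :: "'o \<Rightarrow> 'o \<Rightarrow> 'r set"
  le :: "'o \<Rightarrow> 'o \<Rightarrow> 'r \<Rightarrow> 'r \<Rightarrow> bool"
  reindex :: "'o \<Rightarrow> 'o \<Rightarrow> 'o \<Rightarrow> 'o \<Rightarrow> 'a \<Rightarrow> 'a \<Rightarrow> 'r \<Rightarrow> 'r"
  rident :: "'o \<Rightarrow> 'r"
  rcomp :: "'o \<Rightarrow> 'o \<Rightarrow> 'o \<Rightarrow> 'r \<Rightarrow> 'r \<Rightarrow> 'r"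
  rconv :: "'o \<Rightarrow> 'o \<Rightarrow> 'r \<Rightarrow> 'r"

abbreviation is_rel :: "('o, 'a, 'r) doctrine \<Rightarrow> 'o \<Rightarrow> 'o \<Rightarrow> 'r \<Rightarrow> bool" where
  "is_rel R X Y \<alpha> \<equiv> X \<in> Obj (base R) \<and> Y \<in> Obj (base R) \<and> \<alpha> \<in> Fib R X Y"

locale relational_doctrine =
  fixes R :: "('o, 'a, 'r) doctrine"
  assumes base_category: "category (base R)"
    \<comment> \<open>each \<open>R(X, Y)\<close> is a poset\<close>
    and le_refl: "is_rel R X Y \<alpha> \<Longrightarrow> le R X Y \<alpha> \<alpha>"
    and le_trans: "\<lbrakk>is_rel R X Y \<alpha>; is_rel R X Y \<beta>; is_rel R X Y \<gamma>;
        le R X Y \<alpha> \<beta>; le R X Y \<beta> \<gamma>\<rbrakk> \<Longrightarrow> le R X Y \<alpha> \<gamma>"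
    and le_antisym: "\<lbrakk>is_rel R X Y \<alpha>; is_rel R X Y \<beta>; le R X Y \<alpha> \<beta>; le R X Y \<beta> \<alpha>\<rbrakk> \<Longrightarrow> \<alpha> = \<beta>"
    \<comment> \<open>\<open>R\<close> is a functor from the opposite of the square of the base to posets\<close>
    and reindex_rel: "\<lbrakk>is_arrow (base R) X A f; is_arrow (base R) Y B g; is_rel R A B \<alpha>\<rbrakk> \<Longrightarrow>
        reindex R X A Y B f g \<alpha> \<in> Fib R X Y"
    and reindex_mono: "\<lbrakk>is_arrow (base R) X A f; is_arrow (base R) Y B g;
        is_rel R A B \<alpha>; is_rel R A B \<beta>; le R A B \<alpha> \<beta>\<rbrakk> \<Longrightarrow>
        le R X Y (reindex R X A Y B f g \<alpha>) (reindex R X A Y B f g \<beta>)"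
    and reindex_ident: "is_rel R X Y \<alpha> \<Longrightarrow>
        reindex R X X Y Y (Ident (base R) X) (Ident (base R) Y) \<alpha> = \<alpha>"
    and reindex_comp: "\<lbrakk>is_arrow (base R) X X' f; is_arrow (base R) X' X'' f';
        is_arrow (base R) Y Y' g; is_arrow (base R) Y' Y'' g'; is_rel R X'' Y'' \<alpha>\<rbrakk> \<Longrightarrow>
        reindex R X X'' Y Y'' (Comp (base R) X X' X'' f' f) (Comp (base R) Y Y' Y'' g' g) \<alpha> =
        reindex R X X' Y Y' f g (reindex R X' X'' Y' Y'' f' g' \<alpha>)"
    \<comment> \<open>the relational operations, and their lax compatibility with reindexing\<close>
    and rident_rel: "X \<in> Obj (base R) \<Longrightarrow> rident R X \<in> Fib R X X"
    and rident_reindex: "is_arrow (base R) X Y f \<Longrightarrow>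
        le R X X (rident R X) (reindex R X Y X Y f f (rident R Y))"
    and rcomp_rel: "\<lbrakk>is_rel R X Y \<alpha>; is_rel R Y Z \<beta>\<rbrakk> \<Longrightarrow> rcomp R X Y Z \<alpha> \<beta> \<in> Fib R X Z"
    and rcomp_mono: "\<lbrakk>is_rel R X Y \<alpha>; is_rel R X Y \<alpha>'; is_rel R Y Z \<beta>; is_rel R Y Z \<beta>';
        le R X Y \<alpha> \<alpha>'; le R Y Z \<beta> \<beta>'\<rbrakk> \<Longrightarrow>
        le R X Z (rcomp R X Y Z \<alpha> \<beta>) (rcomp R X Y Z \<alpha>' \<beta>')"
    and rcomp_reindex: "\<lbrakk>is_arrow (base R) X A f; is_arrow (base R) Y B g; is_arrow (base R) Z D h;
        is_rel R A B \<alpha>; is_rel R B D \<beta>\<rbrakk> \<Longrightarrow>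
        le R X Z (rcomp R X Y Z (reindex R X A Y B f g \<alpha>) (reindex R Y B Z D g h \<beta>))
          (reindex R X A Z D f h (rcomp R A B D \<alpha> \<beta>))"
    and rconv_rel: "is_rel R X Y \<alpha> \<Longrightarrow> rconv R X Y \<alpha> \<in> Fib R Y X"
    and rconv_mono: "\<lbrakk>is_rel R X Y \<alpha>; is_rel R X Y \<beta>; le R X Y \<alpha> \<beta>\<rbrakk> \<Longrightarrow>
        le R Y X (rconv R X Y \<alpha>) (rconv R X Y \<beta>)"
    and rconv_reindex: "\<lbrakk>is_arrow (base R) X A f; is_arrow (base R) Y B g; is_rel R A B \<alpha>\<rbrakk> \<Longrightarrow>
        le R Y X (rconv R X Y (reindex R X A Y B f g \<alpha>)) (reindex R Y B X A g f (rconv R A B \<alpha>))"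
    \<comment> \<open>equational laws\<close>
    and rcomp_assoc: "\<lbrakk>is_rel R W X \<alpha>; is_rel R X Y \<beta>; is_rel R Y Z \<gamma>\<rbrakk> \<Longrightarrow>
        rcomp R W X Z \<alpha> (rcomp R X Y Z \<beta> \<gamma>) = rcomp R W Y Z (rcomp R W X Y \<alpha> \<beta>) \<gamma>"
    and rcomp_rident_left: "is_rel R X Y \<alpha> \<Longrightarrow> rcomp R X X Y (rident R X) \<alpha> = \<alpha>"
    and rcomp_rident_right: "is_rel R X Y \<alpha> \<Longrightarrow> rcomp R X Y Y \<alpha> (rident R Y) = \<alpha>"
    and rconv_rcomp: "\<lbrakk>is_rel R X Y \<alpha>; is_rel R Y Z \<beta>\<rbrakk> \<Longrightarrow>
        rconv R X Z (rcomp R X Y Z \<alpha> \<beta>) = rcomp R Z Y X (rconv R Y Z \<beta>) (rconv R X Y \<alpha>)"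
    and rconv_rident: "X \<in> Obj (base R) \<Longrightarrow> rconv R X X (rident R X) = rident R X"
    and rconv_rconv: "is_rel R X Y \<alpha> \<Longrightarrow> rconv R Y X (rconv R X Y \<alpha>) = \<alpha>"

definition graph_of :: "('o, 'a, 'r) doctrine \<Rightarrow> 'o \<Rightarrow> 'o \<Rightarrow> 'a \<Rightarrow> 'r" where
  "graph_of R X Y f = reindex R X Y Y Y f (Ident (base R) Y) (rident R Y)"

abbreviation cograph_of :: "('o, 'a, 'r) doctrine \<Rightarrow> 'o \<Rightarrow> 'o \<Rightarrow> 'a \<Rightarrow> 'r" where
  "cograph_of R X Y f \<equiv> rconv R X Y (graph_of R X Y f)"

text \<open>\<open>kernel_of R X Y f\<close> is \<open>\<Gamma>\<^sub>f ; \<Gamma>\<^sub>f\<^sup>\<bottom>\<close> and \<open>image_of R X Y f\<close> is \<open>\<Gamma>\<^sub>f\<^sup>\<bottom> ; \<Gamma>\<^sub>f\<close>.\<close>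

abbreviation kernel_of :: "('o, 'a, 'r) doctrine \<Rightarrow> 'o \<Rightarrow> 'o \<Rightarrow> 'a \<Rightarrow> 'r" where
  "kernel_of R X Y f \<equiv> rcomp R X Y X (graph_of R X Y f) (cograph_of R X Y f)"

abbreviation image_of :: "('o, 'a, 'r) doctrine \<Rightarrow> 'o \<Rightarrow> 'o \<Rightarrow> 'a \<Rightarrow> 'r" where
  "image_of R X Y f \<equiv> rcomp R Y X Y (cograph_of R X Y f) (graph_of R X Y f)"

definition R_surjective :: "('o, 'a, 'r) doctrine \<Rightarrow> 'o \<Rightarrow> 'o \<Rightarrow> 'a \<Rightarrow> bool" where
  "R_surjective R X Y f \<longleftrightarrow> le R Y Y (rident R Y) (image_of R X Y f)"

definition R_injective :: "('o, 'a, 'r) doctrine \<Rightarrow> 'o \<Rightarrow> 'o \<Rightarrow> 'a \<Rightarrow> bool" where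
  "R_injective R X Y f \<longleftrightarrow> le R X X (kernel_of R X Y f) (rident R X)"

definition R_bijective :: "('o, 'a, 'r) doctrine \<Rightarrow> 'o \<Rightarrow> 'o \<Rightarrow> 'a \<Rightarrow> bool" where
  "R_bijective R X Y f \<longleftrightarrow> R_injective R X Y f \<and> R_surjective R X Y f"

definition balanced_doctrine :: "('o, 'a, 'r) doctrine \<Rightarrow> bool" where
  "balanced_doctrine R \<longleftrightarrow>
    (\<forall>X Y f. is_arrow (base R) X Y f \<and> R_bijective R X Y f \<longrightarrow> is_iso (base R) X Y f)"

definition extensional_doctrine :: "('o, 'a, 'r) doctrine \<Rightarrow> bool" where
  "extensional_doctrine R \<longleftrightarrow>
    (\<forall>X Y f g. is_arrow (base R) X Y f \<and> is_arrow (base R) X Y g \<and>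
      le R X X (rident R X) (reindex R X Y X Y f g (rident R Y)) \<longrightarrow> f = g)"


definition R_equivalence :: "('o, 'a, 'r) doctrine \<Rightarrow> 'o \<Rightarrow> 'r \<Rightarrow> bool" where
  "R_equivalence R X \<rho> \<longleftrightarrow>
    is_rel R X X \<rho> \<and>
    le R X X (rident R X) \<rho> \<and>
    le R X X (rconv R X X \<rho>) \<rho> \<and>
    le R X X (rcomp R X X X \<rho> \<rho>) \<rho>"

definition quotient_arrow_of ::
  "('o, 'a, 'r) doctrine \<Rightarrow> 'o \<Rightarrow> 'r \<Rightarrow> 'o \<Rightarrow> 'a \<Rightarrow> bool" where
  "quotient_arrow_of R X \<rho> W q \<longleftrightarrow>
    is_arrow (base R) X W q \<and>
    le R X X \<rho> (kernel_of R X W q) \<and>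
    (\<forall>Z f. is_arrow (base R) X Z f \<and> le R X X \<rho> (kernel_of R X Z f) \<longrightarrow>
      (\<exists>!h. h \<in> Hom (base R) W Z \<and> f = Comp (base R) X W Z h q))"

definition effective_for :: "('o, 'a, 'r) doctrine \<Rightarrow> 'o \<Rightarrow> 'r \<Rightarrow> 'o \<Rightarrow> 'a \<Rightarrow> bool" where
  "effective_for R X \<rho> W q \<longleftrightarrow> \<rho> = kernel_of R X W q"

definition descent :: "('o, 'a, 'r) doctrine \<Rightarrow> 'o \<Rightarrow> 'o \<Rightarrow> 'a \<Rightarrow> bool" where
  "descent R X W q \<longleftrightarrow> le R W W (rident R W) (image_of R X W q)"

definition has_quotients :: "('o, 'a, 'r) doctrine \<Rightarrow> bool" where
  "has_quotients R \<longleftrightarrow>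
    (\<forall>X \<rho>. R_equivalence R X \<rho> \<longrightarrow>
      (\<exists>W q. quotient_arrow_of R X \<rho> W q \<and> effective_for R X \<rho> W q \<and> descent R X W q))"

definition quotient_arrow :: "('o, 'a, 'r) doctrine \<Rightarrow> 'o \<Rightarrow> 'o \<Rightarrow> 'a \<Rightarrow> bool" where
  "quotient_arrow R X W q \<longleftrightarrow> (\<exists>\<rho>. R_equivalence R X \<rho> \<and> quotient_arrow_of R X \<rho> W q)"

definition R_projective :: "('o, 'a, 'r) doctrine \<Rightarrow> 'o \<Rightarrow> bool" where
  "R_projective R P \<longleftrightarrow>
    P \<in> Obj (base R) \<and>
    (\<forall>X Y f q. is_arrow (base R) P Y f \<and> quotient_arrow R X Y q \<longrightarrow>
      (\<exists>h \<in> Hom (base R) P X. f = Comp (base R) P X Y q h))"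

text \<open>A full subcategory is represented by its set of objects.\<close>

definition R_projective_cover :: "('o, 'a, 'r) doctrine \<Rightarrow> 'o set \<Rightarrow> bool" where
  "R_projective_cover R G \<longleftrightarrow>
    G \<subseteq> Obj (base R) \<and>
    (\<forall>P \<in> G. R_projective R P) \<and>
    (\<forall>X \<in> Obj (base R). \<exists>P \<in> G. \<exists>q. quotient_arrow R P X q)"


record ('o, 'a, 'p, 'b) func =
  on_obj :: "'o \<Rightarrow> 'p"
  on_arr :: "'o \<Rightarrow> 'o \<Rightarrow> 'a \<Rightarrow> 'b"

locale functor_between =
  fixes C :: "('o, 'a) cat" and D :: "('p, 'b) cat" and F :: "('o, 'a, 'p, 'b) func"
  assumes on_obj_obj: "X \<in> Obj C \<Longrightarrow> on_obj F X \<in> Obj D"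
    and on_arr_arrow: "is_arrow C X Y f \<Longrightarrow> on_arr F X Y f \<in> Hom D (on_obj F X) (on_obj F Y)"
    and on_arr_ident: "X \<in> Obj C \<Longrightarrow> on_arr F X X (Ident C X) = Ident D (on_obj F X)"
    and on_arr_comp: "\<lbrakk>is_arrow C X Y f; is_arrow C Y Z g\<rbrakk> \<Longrightarrow>
        on_arr F X Z (Comp C X Y Z g f) =
        Comp D (on_obj F X) (on_obj F Y) (on_obj F Z) (on_arr F Y Z g) (on_arr F X Y f)"

locale natural_transformation =
  fixes C :: "('o, 'a) cat" and D :: "('p, 'b) cat"
    and F G :: "('o, 'a, 'p, 'b) func" and \<theta> :: "'o \<Rightarrow> 'b"
  assumes component_arrow: "X \<in> Obj C \<Longrightarrow> \<theta> X \<in> Hom D (on_obj F X) (on_obj G X)"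
    and naturality: "is_arrow C X Y f \<Longrightarrow>
        Comp D (on_obj F X) (on_obj F Y) (on_obj G Y) (\<theta> Y) (on_arr F X Y f) =
        Comp D (on_obj F X) (on_obj G X) (on_obj G Y) (on_arr G X Y f) (\<theta> X)"

record ('o, 'a, 'r, 'p, 'b, 's) one_arrow =
  fun_part :: "('o, 'a, 'p, 'b) func"
  rel_part :: "'o \<Rightarrow> 'o \<Rightarrow> 'r \<Rightarrow> 's"

abbreviation ob :: "('o, 'a, 'r, 'p, 'b, 's) one_arrow \<Rightarrow> 'o \<Rightarrow> 'p" where
  "ob F \<equiv> on_obj (fun_part F)"

abbreviation ar :: "('o, 'a, 'r, 'p, 'b, 's) one_arrow \<Rightarrow> 'o \<Rightarrow> 'o \<Rightarrow> 'a \<Rightarrow> 'b" where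
  "ar F \<equiv> on_arr (fun_part F)"

locale RD_one_arrow =
  fixes R :: "('o, 'a, 'r) doctrine" and S :: "('p, 'b, 's) doctrine"
    and F :: "('o, 'a, 'r, 'p, 'b, 's) one_arrow"
  assumes fun_part_functor: "functor_between (base R) (base S) (fun_part F)"
    and rel_part_rel: "is_rel R X Y \<alpha> \<Longrightarrow> rel_part F X Y \<alpha> \<in> Fib S (ob F X) (ob F Y)"
    and rel_part_mono: "\<lbrakk>is_rel R X Y \<alpha>; is_rel R X Y \<beta>; le R X Y \<alpha> \<beta>\<rbrakk> \<Longrightarrow>
        le S (ob F X) (ob F Y) (rel_part F X Y \<alpha>) (rel_part F X Y \<beta>)"
    and rel_part_natural:
      "\<lbrakk>is_arrow (base R) X A f; is_arrow (base R) Y B g; is_rel R A B \<alpha>\<rbrakk> \<Longrightarrow>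
        rel_part F X Y (reindex R X A Y B f g \<alpha>) =
        reindex S (ob F X) (ob F A) (ob F Y) (ob F B) (ar F X A f) (ar F Y B g) (rel_part F A B \<alpha>)"
    and rel_part_rident: "X \<in> Obj (base R) \<Longrightarrow> rel_part F X X (rident R X) = rident S (ob F X)"
    and rel_part_rcomp: "\<lbrakk>is_rel R X Y \<alpha>; is_rel R Y Z \<beta>\<rbrakk> \<Longrightarrow>
        rel_part F X Z (rcomp R X Y Z \<alpha> \<beta>) =
        rcomp S (ob F X) (ob F Y) (ob F Z) (rel_part F X Y \<alpha>) (rel_part F Y Z \<beta>)"
    and rel_part_rconv: "is_rel R X Y \<alpha> \<Longrightarrow>
        rel_part F Y X (rconv R X Y \<alpha>) = rconv S (ob F X) (ob F Y) (rel_part F X Y \<alpha>)"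

locale RD_two_arrow =
  fixes R :: "('o, 'a, 'r) doctrine" and S :: "('p, 'b, 's) doctrine"
    and F G :: "('o, 'a, 'r, 'p, 'b, 's) one_arrow" and \<theta> :: "'o \<Rightarrow> 'b"
  assumes natural: "natural_transformation (base R) (base S) (fun_part F) (fun_part G) \<theta>"
    and lax: "is_rel R X Y \<alpha> \<Longrightarrow>
        le S (ob F X) (ob F Y) (rel_part F X Y \<alpha>)
          (reindex S (ob F X) (ob G X) (ob F Y) (ob G Y) (\<theta> X) (\<theta> Y) (rel_part G X Y \<alpha>))"

definition id_one_arrow :: "('o, 'a, 'r, 'o, 'a, 'r) one_arrow" where
  "id_one_arrow =
    \<lparr>fun_part = \<lparr>on_obj = (\<lambda>X. X), on_arr = (\<lambda>X Y f. f)\<rparr>, rel_part = (\<lambda>X Y \<alpha>. \<alpha>)\<rparr>"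

definition comp_one_arrow ::
  "('p, 'b, 's, 'q, 'c, 't) one_arrow \<Rightarrow> ('o, 'a, 'r, 'p, 'b, 's) one_arrow \<Rightarrow>
    ('o, 'a, 'r, 'q, 'c, 't) one_arrow" where
  "comp_one_arrow G F =
    \<lparr>fun_part =
       \<lparr>on_obj = (\<lambda>X. ob G (ob F X)),
        on_arr = (\<lambda>X Y f. ar G (ob F X) (ob F Y) (ar F X Y f))\<rparr>,
     rel_part = (\<lambda>X Y \<alpha>. rel_part G (ob F X) (ob F Y) (rel_part F X Y \<alpha>))\<rparr>"

locale RD_monad =
  fixes R :: "('o, 'a, 'r) doctrine" and T :: "('o, 'a, 'r, 'o, 'a, 'r) one_arrow"
    and \<eta> \<mu> :: "'o \<Rightarrow> 'a"
  assumes one_arrow: "RD_one_arrow R R T"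
    and unit: "RD_two_arrow R R id_one_arrow T \<eta>"
    and mult: "RD_two_arrow R R (comp_one_arrow T T) T \<mu>"
    and mult_assoc: "X \<in> Obj (base R) \<Longrightarrow>
        Comp (base R) (ob T (ob T (ob T X))) (ob T (ob T X)) (ob T X)
          (\<mu> X) (ar T (ob T (ob T X)) (ob T X) (\<mu> X)) =
        Comp (base R) (ob T (ob T (ob T X))) (ob T (ob T X)) (ob T X) (\<mu> X) (\<mu> (ob T X))"
    and mult_unit_left: "X \<in> Obj (base R) \<Longrightarrow>
        Comp (base R) (ob T X) (ob T (ob T X)) (ob T X) (\<mu> X) (\<eta> (ob T X)) =
        Ident (base R) (ob T X)"
    and mult_unit_right: "X \<in> Obj (base R) \<Longrightarrow>
        Comp (base R) (ob T X) (ob T (ob T X)) (ob T X) (\<mu> X) (ar T X (ob T X) (\<eta> X)) =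
        Ident (base R) (ob T X)"


definition EM_algebra ::
  "('o, 'a) cat \<Rightarrow> ('o, 'a, 'o, 'a) func \<Rightarrow> ('o \<Rightarrow> 'a) \<Rightarrow> ('o \<Rightarrow> 'a) \<Rightarrow> 'o \<Rightarrow> 'a \<Rightarrow> bool" where
  "EM_algebra C T \<eta> \<mu> X a \<longleftrightarrow>
    X \<in> Obj C \<and> a \<in> Hom C (on_obj T X) X \<and>
    Comp C X (on_obj T X) X a (\<eta> X) = Ident C X \<and>
    Comp C (on_obj T (on_obj T X)) (on_obj T X) X a (\<mu> X) =
    Comp C (on_obj T (on_obj T X)) (on_obj T X) X a (on_arr T (on_obj T X) X a)"

definition EM_hom ::
  "('o, 'a) cat \<Rightarrow> ('o, 'a, 'o, 'a) func \<Rightarrow> 'o \<times> 'a \<Rightarrow> 'o \<times> 'a \<Rightarrow> 'a set" where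
  "EM_hom C T = (\<lambda>(X, a) (Y, b).
    {f \<in> Hom C X Y.
      Comp C (on_obj T X) X Y f a = Comp C (on_obj T X) (on_obj T Y) Y b (on_arr T X Y f)})"

definition EM_category ::
  "('o, 'a) cat \<Rightarrow> ('o, 'a, 'o, 'a) func \<Rightarrow> ('o \<Rightarrow> 'a) \<Rightarrow> ('o \<Rightarrow> 'a) \<Rightarrow> ('o \<times> 'a, 'a) cat" where
  "EM_category C T \<eta> \<mu> =
    \<lparr>Obj = {(X, a). EM_algebra C T \<eta> \<mu> X a},
     Hom = EM_hom C T,
     Ident = (\<lambda>(X, a). Ident C X),
     Comp = (\<lambda>(X, a) (Y, b) (Z, c). Comp C X Y Z)\<rparr>"

definition free_algebras ::
  "('o, 'a) cat \<Rightarrow> ('o, 'a, 'o, 'a) func \<Rightarrow> ('o \<Rightarrow> 'a) \<Rightarrow> ('o \<times> 'a) set" where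
  "free_algebras C T \<mu> = {(on_obj T X, \<mu> X) | X. X \<in> Obj C}"

definition EM_doctrine ::
  "('o, 'a, 'r) doctrine \<Rightarrow> ('o, 'a, 'r, 'o, 'a, 'r) one_arrow \<Rightarrow> ('o \<Rightarrow> 'a) \<Rightarrow> ('o \<Rightarrow> 'a) \<Rightarrow>
    ('o \<times> 'a, 'a, 'r) doctrine" where
  "EM_doctrine R T \<eta> \<mu> =
    \<lparr>base = EM_category (base R) (fun_part T) \<eta> \<mu>,
     Fib = (\<lambda>(X, a) (Y, b).
       {\<alpha> \<in> Fib R X Y.
         le R X Y
           (rcomp R X (ob T Y) Y
             (rcomp R X (ob T X) (ob T Y) (cograph_of R (ob T X) X a) (rel_part T X Y \<alpha>))
             (graph_of R (ob T Y) Y b))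
           \<alpha>}),
     le = (\<lambda>(X, a) (Y, b). le R X Y),
     reindex = (\<lambda>(X, a) (A, a') (Y, b) (B, b'). reindex R X A Y B),
     rident = (\<lambda>(X, a). rident R X),
     rcomp = (\<lambda>(X, a) (Y, b) (Z, c). rcomp R X Y Z),
     rconv = (\<lambda>(X, a) (Y, b). rconv R X Y)\<rparr>"

end

theory Submission
  imports Defs
begin

text \<open>
  The argument treats relations through their elements. The statement \<open>d\<^sub>Z \<le> R\<^bsub>u,v\<^esub>(\<rho>)\<close> says
  that \<open>u z\<close> and \<open>v z\<close> are \<open>\<rho>\<close>-related for all \<open>z\<close>; the kernel of \<open>f\<close> is \<open>R\<^bsub>f,f\<^esub>(d)\<close>; and a
  relation \<open>\<alpha>\<close> belongs to the Eilenberg--Moore doctrine over \<open>(X, a)\<close> and \<open>(Y, b)\<close> exactly when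
  \<open>T \<alpha> \<le> R\<^bsub>a,b\<^esub>(\<alpha>)\<close>. The last two translations rest on \<open>R\<^bsub>f,g\<^esub>(\<alpha>) = \<Gamma>\<^sub>f ; \<alpha> ; \<Gamma>\<^sub>g\<^sup>\<bottom>\<close>
  and on the adjunction between \<open>\<alpha> \<mapsto> \<Gamma>\<^sub>f\<^sup>\<bottom> ; \<alpha> ; \<Gamma>\<^sub>g\<close> and reindexing
  (\<open>reindex_as_rcomp\<close>, \<open>direct_image_le_iff\<close>).

  Suppose surjective arrows split. An equivalence relation \<open>\<rho>\<close> on an algebra \<open>(X, a)\<close> has a
  quotient \<open>q : X \<rightarrow> W\<close> in \<open>R\<close>, with a section \<open>s\<close>. The map \<open>w = q \<circ> a \<circ> T s\<close> is an algebra structure for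
  which \<open>q\<close> is a homomorphism, because \<open>T\<close> preserves relations and \<open>\<rho>\<close> is compatible with \<open>a\<close>, so that
  the choice of representatives made by \<open>s\<close> is irrelevant (\<open>algebra_on_quotient\<close>). A homomorphism
  that splits in the base is a quotient of its kernel among algebras (\<open>split_epi_quotient\<close>), since
  equations between arrows out of \<open>T W\<close> can be tested after the split arrow \<open>T q\<close>. This yields
  quotients, and also the cover of \<open>(X, a)\<close> by the free algebra on \<open>X\<close>, as \<open>a\<close> is split by \<open>\<eta>\<^sub>X\<close>.
  Moreover, every quotient arrow of algebras splits in the base, so an arrow out of a free algebra
  lifts by lifting its transpose there. Balancedness holds because an injective arrow with a section
  is invertible.

  For the other direction the identity monad suffices: its algebras are the objects of the base, all
  free and hence projective. A surjective \<open>f\<close> factors as the quotient \<open>q\<close> of its kernel followed by a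
  bijective arrow; the latter is invertible by balancedness, and \<open>q\<close> splits by projectivity of its
  codomain (\<open>surjective_splits_if_all_projective\<close>).
\<close>

section \<open>Graphs, direct images and kernels\<close>

context relational_doctrine
begin

lemmas cat_laws =
  category.ident_arrow[OF base_category] category.comp_arrow[OF base_category]
  category.comp_ident_right[OF base_category] category.comp_ident_left[OF base_category]

lemmas typing = cat_laws reindex_rel rident_rel rcomp_rel rconv_rel

lemma reindex_rconv:
  assumes "is_arrow (base R) X A f" "is_arrow (base R) Y B g" "is_rel R A B \<alpha>"
  shows "rconv R X Y (reindex R X A Y B f g \<alpha>) = reindex R Y B X A g f (rconv R A B \<alpha>)"
proof (rule le_antisym[of Y X])
  have "le R X Y (rconv R Y X (reindex R Y B X A g f (rconv R A B \<alpha>))) (reindex R X A Y B f g \<alpha>)"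
    using rconv_reindex[of Y B g X A f "rconv R A B \<alpha>"] assms by (simp add: typing rconv_rconv)
  from rconv_mono[OF _ _ this]
  show "le R Y X (reindex R Y B X A g f (rconv R A B \<alpha>)) (rconv R X Y (reindex R X A Y B f g \<alpha>))"
    using assms by (simp add: typing rconv_rconv)
qed (use assms rconv_reindex in \<open>simp_all add: typing\<close>)

lemma graph_rel: "is_arrow (base R) X Y f \<Longrightarrow> graph_of R X Y f \<in> Fib R X Y"
  by (simp add: graph_of_def typing)

lemma cograph_eq:
  assumes "is_arrow (base R) X Y f"
  shows "cograph_of R X Y f = reindex R Y Y X Y (Ident (base R) Y) f (rident R Y)"
  using assms by (simp add: graph_of_def reindex_rconv typing rconv_rident)

lemma graph_le:
  assumes "is_arrow (base R) X Y f"
  shows "le R X Y (graph_of R X Y f) (reindex R X Y Y Y f (Ident (base R) Y) (rident R Y))"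
  using assms by (simp add: graph_of_def le_refl typing)

lemma cograph_le:
  assumes "is_arrow (base R) X Y f"
  shows "le R Y X (cograph_of R X Y f) (reindex R Y Y X Y (Ident (base R) Y) f (rident R Y))"
  using assms by (simp add: cograph_eq le_refl typing)

lemma reindex_reindex:
  assumes "is_arrow (base R) X X' f" "is_arrow (base R) X' X'' f'"
    "is_arrow (base R) Y Y' g" "is_arrow (base R) Y' Y'' g'" "is_rel R X'' Y'' \<alpha>"
  shows "reindex R X X' Y Y' f g (reindex R X' X'' Y' Y'' f' g' \<alpha>) =
    reindex R X X'' Y Y'' (Comp (base R) X X' X'' f' f) (Comp (base R) Y Y' Y'' g' g) \<alpha>"
  using reindex_comp assms by simp

text \<open>
  The universal property of the graph as a restriction: the inequality
  \<open>d\<^sub>X \<le> R\<^bsub>f,f\<^esub>(d\<^sub>Y)\<close> factors through reindexing along \<open>f\<close> in one variable only. The two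
  halves, for \<open>\<Gamma>\<^sub>f\<close> and for \<open>\<Gamma>\<^sub>f\<^sup>\<bottom>\<close>, can then be composed horizontally, which is what makes lower
  bounds on composites such as \<open>d\<^sub>X \<le> \<Gamma>\<^sub>f ; \<Gamma>\<^sub>f\<^sup>\<bottom>\<close> available although \<open>;\<close> is only laxly natural.
\<close>

lemma rident_le_reindex_graph:
  assumes "is_arrow (base R) X Y f"
  shows "le R X X (rident R X) (reindex R X X X Y (Ident (base R) X) f (graph_of R X Y f))"
  using rident_reindex[OF assms] assms by (simp add: graph_of_def reindex_reindex typing)

lemma rident_le_reindex_cograph:
  assumes "is_arrow (base R) X Y f"
  shows "le R X X (rident R X) (reindex R X Y X X f (Ident (base R) X) (cograph_of R X Y f))"
  using rident_reindex[OF assms] assms by (simp add: cograph_eq reindex_reindex typing)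

text \<open>
  Read \<open>\<alpha>' \<le> R\<^bsub>f,g\<^esub>(\<alpha>)\<close> as a cell from \<open>\<alpha>'\<close> to \<open>\<alpha>\<close> over \<open>(f, g)\<close>; three such cells with
  matching sides compose horizontally. All comparisons between reindexing and composition with
  graphs below are instances of this.
\<close>

lemma rcomp3_reindex:
  assumes "is_arrow (base R) W W' f" "is_arrow (base R) X X' g"
    "is_arrow (base R) Y Y' h" "is_arrow (base R) Z Z' k"
    "is_rel R W' X' \<alpha>" "is_rel R X' Y' \<beta>" "is_rel R Y' Z' \<gamma>"
    "is_rel R W X \<alpha>'" "is_rel R X Y \<beta>'" "is_rel R Y Z \<gamma>'"
    "le R W X \<alpha>' (reindex R W W' X X' f g \<alpha>)"
    "le R X Y \<beta>' (reindex R X X' Y Y' g h \<beta>)"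
    "le R Y Z \<gamma>' (reindex R Y Y' Z Z' h k \<gamma>)"
  shows "le R W Z (rcomp R W Y Z (rcomp R W X Y \<alpha>' \<beta>') \<gamma>')
    (reindex R W W' Z Z' f k (rcomp R W' Y' Z' (rcomp R W' X' Y' \<alpha> \<beta>) \<gamma>))"
proof -
  let ?ab = "rcomp R W X Y (reindex R W W' X X' f g \<alpha>) (reindex R X X' Y Y' g h \<beta>)"
  have "le R W Y (rcomp R W X Y \<alpha>' \<beta>') ?ab"
    using assms by (intro rcomp_mono) (simp_all add: typing)
  moreover have "le R W Y ?ab (reindex R W W' Y Y' f h (rcomp R W' X' Y' \<alpha> \<beta>))"
    using assms by (intro rcomp_reindex) simp_all
  ultimately have "le R W Y (rcomp R W X Y \<alpha>' \<beta>')
      (reindex R W W' Y Y' f h (rcomp R W' X' Y' \<alpha> \<beta>))"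
    using assms by (rule_tac le_trans[of W Y _ ?ab]) (simp_all add: typing)
  then have "le R W Z (rcomp R W Y Z (rcomp R W X Y \<alpha>' \<beta>') \<gamma>')
    (rcomp R W Y Z (reindex R W W' Y Y' f h (rcomp R W' X' Y' \<alpha> \<beta>))
      (reindex R Y Y' Z Z' h k \<gamma>))" (is "le R W Z _ ?m")
    using assms by (intro rcomp_mono) (simp_all add: typing)
  moreover have "le R W Z ?m
      (reindex R W W' Z Z' f k (rcomp R W' Y' Z' (rcomp R W' X' Y' \<alpha> \<beta>) \<gamma>))"
    using assms by (intro rcomp_reindex) (simp_all add: typing)
  ultimately show ?thesis
    using assms by (rule_tac le_trans[of W Z _ ?m]) (simp_all add: typing)
qed

text \<open>
  One inequality comes from the cells
  \<open>d\<^sub>X \<le> R\<^bsub>id,f\<^esub>(\<Gamma>\<^sub>f)\<close> and \<open>d\<^sub>Y \<le> R\<^bsub>g,id\<^esub>(\<Gamma>\<^sub>g\<^sup>\<bottom>)\<close> placed on both sides of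
  \<open>R\<^bsub>f,g\<^esub>(\<alpha>)\<close>, the other from the definitions of \<open>\<Gamma>\<^sub>f\<close> and \<open>\<Gamma>\<^sub>g\<^sup>\<bottom>\<close> as reindexings of \<open>d\<close>.
\<close>

lemma reindex_as_rcomp:
  assumes "is_arrow (base R) X A f" "is_arrow (base R) Y B g" "is_rel R A B \<alpha>"
  shows "reindex R X A Y B f g \<alpha> =
    rcomp R X B Y (rcomp R X A B (graph_of R X A f) \<alpha>) (cograph_of R Y B g)"
    (is "?l = ?r")
proof (rule le_antisym[of X Y])
  have "le R X Y (rcomp R X Y Y (rcomp R X X Y (rident R X) ?l) (rident R Y))
      (reindex R X X Y Y (Ident (base R) X) (Ident (base R) Y) ?r)"
    using assms
    by (intro rcomp3_reindex[where g = f and h = g]) (simp_all add: typing graph_rel le_refl rident_le_reindex_graph rident_le_reindex_cograph)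
  then show "le R X Y ?l ?r"
    using assms
    by (simp add: typing graph_rel rcomp_rident_left rcomp_rident_right reindex_ident)
  have "le R X Y ?r (reindex R X A Y B f g (rcomp R A B B (rcomp R A A B (rident R A) \<alpha>) (rident R B)))"
    using assms
    by (intro rcomp3_reindex[where g = "Ident (base R) A" and h = "Ident (base R) B"])
       (simp_all add: typing graph_rel le_refl reindex_ident graph_le cograph_le)
  then show "le R X Y ?r ?l"
    using assms by (simp add: rcomp_rident_left rcomp_rident_right)
qed (use assms in \<open>simp_all add: typing graph_rel\<close>)

text \<open>
  This form lets kernels be handled by functoriality of reindexing alone, without any
  manipulation of composites of relations.
\<close>

lemma kernel_eq_reindex:
  assumes "is_arrow (base R) X Y f"
  shows "kernel_of R X Y f = reindex R X Y X Y f f (rident R Y)"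
  using assms by (simp add: reindex_as_rcomp typing graph_rel rcomp_rident_right)

abbreviation direct_image where
  "direct_image X A Y B f g \<alpha> \<equiv>
    rcomp R A Y B (rcomp R A X Y (cograph_of R X A f) \<alpha>) (graph_of R Y B g)"

lemma le_reindex_direct_image:
  assumes "is_arrow (base R) X A f" "is_arrow (base R) Y B g" "is_rel R X Y \<alpha>"
  shows "le R X Y \<alpha> (reindex R X A Y B f g (direct_image X A Y B f g \<alpha>))"
proof -
  have "le R X Y (rcomp R X Y Y (rcomp R X X Y (rident R X) \<alpha>) (rident R Y))
      (reindex R X A Y B f g (direct_image X A Y B f g \<alpha>))"
    using assms
    by (intro rcomp3_reindex[where g = "Ident (base R) X" and h = "Ident (base R) Y"])
       (simp_all add: typing graph_rel le_refl reindex_ident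
         rident_le_reindex_graph rident_le_reindex_cograph)
  then show ?thesis
    using assms by (simp add: rcomp_rident_left rcomp_rident_right)
qed

lemma direct_image_reindex_le:
  assumes "is_arrow (base R) X A f" "is_arrow (base R) Y B g" "is_rel R A B \<beta>"
  shows "le R A B (direct_image X A Y B f g (reindex R X A Y B f g \<beta>)) \<beta>"
proof -
  have "le R A B (direct_image X A Y B f g (reindex R X A Y B f g \<beta>))
      (reindex R A A B B (Ident (base R) A) (Ident (base R) B)
        (rcomp R A B B (rcomp R A A B (rident R A) \<beta>) (rident R B)))"
    using assms
    by (intro rcomp3_reindex[where g = f and h = g])
       (simp_all add: typing graph_rel le_refl graph_le cograph_le)
  then show ?thesis
    using assms by (simp add: rcomp_rident_left rcomp_rident_right reindex_ident)
qed

lemma direct_image_mono: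
  assumes "is_arrow (base R) X A f" "is_arrow (base R) Y B g"
    "is_rel R X Y \<alpha>" "is_rel R X Y \<beta>" "le R X Y \<alpha> \<beta>"
  shows "le R A B (direct_image X A Y B f g \<alpha>) (direct_image X A Y B f g \<beta>)"
  using assms by (intro rcomp_mono) (simp_all add: typing graph_rel le_refl)

text \<open>
  Direct image is left adjoint to reindexing; its unit and counit are
  \<open>le_reindex_direct_image\<close> and \<open>direct_image_reindex_le\<close>. The defining condition of the fibres of the Eilenberg--Moore doctrine is of the left-hand form and is
  used through the right-hand form.
\<close>

lemma direct_image_le_iff:
  assumes "is_arrow (base R) X A f" "is_arrow (base R) Y B g"
    "is_rel R X Y \<alpha>" "is_rel R A B \<beta>"
  shows "le R A B (direct_image X A Y B f g \<alpha>) \<beta> \<longleftrightarrow> le R X Y \<alpha> (reindex R X A Y B f g \<beta>)"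
proof
  assume "le R A B (direct_image X A Y B f g \<alpha>) \<beta>"
  then have "le R X Y (reindex R X A Y B f g (direct_image X A Y B f g \<alpha>)) (reindex R X A Y B f g \<beta>)"
    using assms by (intro reindex_mono) (simp_all add: typing graph_rel)
  with le_reindex_direct_image[OF assms(1-3)] show "le R X Y \<alpha> (reindex R X A Y B f g \<beta>)"
    using assms by (rule_tac le_trans[of X Y _ "reindex R X A Y B f g (direct_image X A Y B f g \<alpha>)"])
      (simp_all add: typing graph_rel)
next
  assume "le R X Y \<alpha> (reindex R X A Y B f g \<beta>)"
  then have "le R A B (direct_image X A Y B f g \<alpha>) (direct_image X A Y B f g (reindex R X A Y B f g \<beta>))"
    using assms by (intro direct_image_mono) (simp_all add: typing)
  with direct_image_reindex_le[OF assms(1,2,4)] show "le R A B (direct_image X A Y B f g \<alpha>) \<beta>"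
    using assms by (rule_tac le_trans[of A B _ "direct_image X A Y B f g (reindex R X A Y B f g \<beta>)"])
      (simp_all add: typing graph_rel)
qed

lemma image_eq_direct_image:
  assumes "is_arrow (base R) X Y f"
  shows "image_of R X Y f = direct_image X Y X Y f f (rident R X)"
  using assms by (simp add: typing graph_rel rcomp_rident_right)

text \<open>
  For surjective \<open>q\<close> every \<open>\<alpha>\<close> lies below the direct image of its own reindexing, since
  \<open>\<alpha> = d ; \<alpha> ; d \<le> (\<Gamma>\<^sub>q\<^sup>\<bottom> ; \<Gamma>\<^sub>q) ; \<alpha> ; (\<Gamma>\<^sub>q\<^sup>\<bottom> ; \<Gamma>\<^sub>q)\<close>.
\<close>

lemma surjective_reindex_reflects_le:
  assumes q: "is_arrow (base R) X Y q" and surj: "R_surjective R X Y q"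
    and rels: "is_rel R Y Y \<alpha>" "is_rel R Y Y \<beta>"
    and le: "le R X X (reindex R X Y X Y q q \<alpha>) (reindex R X Y X Y q q \<beta>)"
  shows "le R Y Y \<alpha> \<beta>"
proof -
  let ?i = "image_of R X Y q" and ?d = "rident R Y"
  have "le R Y Y (rcomp R Y Y Y (rcomp R Y Y Y ?d \<alpha>) ?d) (rcomp R Y Y Y (rcomp R Y Y Y ?i \<alpha>) ?i)"
    using q rels surj by (intro rcomp_mono) (simp_all add: R_surjective_def typing graph_rel le_refl)
  also have "rcomp R Y Y Y (rcomp R Y Y Y ?d \<alpha>) ?d = \<alpha>"
    using rels by (simp add: rcomp_rident_left rcomp_rident_right)
  also have "rcomp R Y Y Y (rcomp R Y Y Y ?i \<alpha>) ?i = direct_image X Y X Y q q (reindex R X Y X Y q q \<alpha>)"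
    using q rels by (simp add: reindex_as_rcomp typing graph_rel rcomp_assoc)
  finally have "le R Y Y \<alpha> (direct_image X Y X Y q q (reindex R X Y X Y q q \<alpha>))" .
  moreover have "le R Y Y (direct_image X Y X Y q q (reindex R X Y X Y q q \<alpha>)) \<beta>"
    using q rels le by (subst direct_image_le_iff) (simp_all add: typing)
  ultimately show ?thesis
    using q rels by (rule_tac le_trans[of Y Y _ "direct_image X Y X Y q q (reindex R X Y X Y q q \<alpha>)"])
      (simp_all add: typing graph_rel)
qed

text \<open>
  The image of \<open>h \<circ> q\<close> is contained in the image of \<open>h\<close>.
\<close>

lemma surjective_cancel:
  assumes q: "is_arrow (base R) X W q" and h: "is_arrow (base R) W Y h"
    and surj: "R_surjective R X Y (Comp (base R) X W Y h q)"
  shows "R_surjective R W Y h"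
proof -
  let ?hq = "Comp (base R) X W Y h q"
  let ?i = "image_of R W Y h"
  have hq: "is_arrow (base R) X Y ?hq" using q h by (simp add: typing)
  have i: "is_rel R Y Y ?i" using h by (simp add: typing graph_rel)
  have "le R W W (rident R W) (reindex R W Y W Y h h ?i)"
    using h le_reindex_direct_image[of W Y h W Y h "rident R W"]
    by (simp add: image_eq_direct_image typing)
  then have "le R X X (reindex R X W X W q q (rident R W)) (reindex R X Y X Y ?hq ?hq ?i)"
    using q h i reindex_mono[of X W q X W q "rident R W" "reindex R W Y W Y h h ?i"]
    by (simp add: reindex_reindex typing)
  with rident_reindex[OF q] have "le R X X (rident R X) (reindex R X Y X Y ?hq ?hq ?i)"
    using q hq i by (rule_tac le_trans[of X X _ "reindex R X W X W q q (rident R W)"]) (simp_all add: typing)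
  then have "le R Y Y (image_of R X Y ?hq) ?i"
    using hq i by (subst image_eq_direct_image[OF hq], subst direct_image_le_iff) (simp_all add: typing)
  with surj hq i show ?thesis
    unfolding R_surjective_def by (rule_tac le_trans[of Y Y _ "image_of R X Y ?hq"]) (simp_all add: typing graph_rel)
qed

lemma kernel_equivalence:
  assumes f: "is_arrow (base R) X Y f"
  shows "R_equivalence R X (kernel_of R X Y f)"
  using rident_reindex[OF f] rconv_reindex[of X Y f X Y f "rident R Y"]
    rcomp_reindex[of X Y f X Y f X Y f "rident R Y" "rident R Y"] f
  by (simp add: R_equivalence_def kernel_eq_reindex typing rconv_rident rcomp_rident_left)

text \<open>
  The hypothesis on \<open>u\<close> and \<open>v\<close> is the internal way of saying that \<open>u z\<close> and \<open>v z\<close> are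
  \<open>\<rho>\<close>-related for all \<open>z\<close>. An arrow whose kernel contains \<open>\<rho>\<close> then sends them to equal values, and
  extensionality turns this into equality of arrows.
\<close>

lemma arrows_identify_through:
  assumes ext: "extensional_doctrine R"
    and u: "is_arrow (base R) Z X u" and v: "is_arrow (base R) Z X v" and f: "is_arrow (base R) X Y f"
    and \<rho>: "is_rel R X X \<rho>" "le R Z Z (rident R Z) (reindex R Z X Z X u v \<rho>)"
    and ker: "le R X X \<rho> (kernel_of R X Y f)"
  shows "Comp (base R) Z X Y f u = Comp (base R) Z X Y f v"
proof -
  have "le R Z Z (reindex R Z X Z X u v \<rho>) (reindex R Z X Z X u v (kernel_of R X Y f))"
    using assms by (intro reindex_mono) (simp_all add: typing graph_rel)
  also have "reindex R Z X Z X u v (kernel_of R X Y f) =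
      reindex R Z Y Z Y (Comp (base R) Z X Y f u) (Comp (base R) Z X Y f v) (rident R Y)"
    using u v f by (simp add: kernel_eq_reindex reindex_reindex typing)
  finally have "le R Z Z (rident R Z)
      (reindex R Z Y Z Y (Comp (base R) Z X Y f u) (Comp (base R) Z X Y f v) (rident R Y))"
    using u v f \<rho> by (rule_tac le_trans[of Z Z _ "reindex R Z X Z X u v \<rho>"]) (simp_all add: typing)
  moreover have "is_arrow (base R) Z Y (Comp (base R) Z X Y f u)" "is_arrow (base R) Z Y (Comp (base R) Z X Y f v)"
    using u v f by (simp_all add: typing)
  ultimately show ?thesis
    using ext unfolding extensional_doctrine_def by blast
qed

end

section \<open>Split arrows and quotients\<close>

lemma (in category) split_epi_cancel:
  assumes "is_arrow C X W q" "is_arrow C W X s" "Comp C W X W q s = Ident C W"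
    "is_arrow C W Z g" "is_arrow C W Z h"
    "Comp C X W Z g q = Comp C X W Z h q"
  shows "g = h"
proof -
  have "Comp C W X Z (Comp C X W Z g q) s = Comp C W X Z (Comp C X W Z h q) s"
    using assms by simp
  then show ?thesis
    using assms(1-5) by (simp add: comp_assoc[symmetric] comp_ident_right)
qed

context relational_doctrine
begin

abbreviation surjective_arrows_split :: bool where
  "surjective_arrows_split \<equiv>
    \<forall>X Y f. is_arrow (base R) X Y f \<and> R_surjective R X Y f \<longrightarrow> splits (base R) X Y f"

lemmas comp_assoc = category.comp_assoc[OF base_category]

text \<open>
  Internally: \<open>s (q x)\<close> and \<open>x\<close> have the same image under \<open>q\<close>.
\<close>

lemma section_kernel:
  assumes q: "is_arrow (base R) X W q" and s: "is_arrow (base R) W X s"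
    and sec: "Comp (base R) W X W q s = Ident (base R) W"
  shows "le R X X (rident R X)
    (reindex R X X X X (Comp (base R) X W X s q) (Ident (base R) X) (kernel_of R X W q))"
  using rident_reindex[OF q] q s
  by (simp add: kernel_eq_reindex reindex_reindex typing comp_assoc sec)

text \<open>
  A section turns kernel inclusion into an explicit factorisation, so split arrows are quotients of
  their kernels.
\<close>

lemma split_epi_factor:
  assumes ext: "extensional_doctrine R"
    and q: "is_arrow (base R) X W q" and s: "is_arrow (base R) W X s"
    and sec: "Comp (base R) W X W q s = Ident (base R) W"
    and f: "is_arrow (base R) X Z f"
    and ker: "le R X X (kernel_of R X W q) (kernel_of R X Z f)"
  shows "Comp (base R) X W Z (Comp (base R) W X Z f s) q = f"
  using arrows_identify_through[OF ext _ _ f _ section_kernel[OF q s sec] ker] q s f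
  by (simp add: typing graph_rel comp_assoc)

text \<open>
  Surjectivity of \<open>h\<close> follows by cancellation; for injectivity, the kernel of \<open>h\<close> and \<open>d\<close> have the
  same reindexing along the surjective \<open>q\<close>.
\<close>

lemma bijective_factor:
  assumes q: "is_arrow (base R) X W q" and h: "is_arrow (base R) W Y h"
    and qs: "R_surjective R X W q"
    and surj: "R_surjective R X Y (Comp (base R) X W Y h q)"
    and ker: "kernel_of R X Y (Comp (base R) X W Y h q) = kernel_of R X W q"
  shows "R_bijective R W Y h"
proof -
  let ?k = "kernel_of R W Y h"
  have "reindex R X W X W q q ?k = reindex R X W X W q q (rident R W)"
    using q h ker by (simp add: kernel_eq_reindex reindex_reindex typing)
  then have "le R W W ?k (rident R W)"
    using surjective_reindex_reflects_le[OF q qs, of ?k "rident R W"] q h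
    by (simp add: typing graph_rel le_refl)
  then show ?thesis
    using surjective_cancel[OF q h surj] by (simp add: R_bijective_def R_injective_def)
qed

text \<open>
  Factor \<open>f\<close> as \<open>h \<circ> q\<close>, where \<open>q\<close> is the quotient of the kernel of \<open>f\<close>. The comparison \<open>h\<close> is
  bijective, hence invertible, and \<open>q\<close> splits because its codomain is projective.
\<close>

lemma surjective_splits_if_all_projective:
  assumes bal: "balanced_doctrine R" and quot: "has_quotients R"
    and proj: "\<And>P. P \<in> Obj (base R) \<Longrightarrow> R_projective R P"
    and f: "is_arrow (base R) X Y f" and surj: "R_surjective R X Y f"
  shows "splits (base R) X Y f"
proof -
  obtain W q where q: "quotient_arrow_of R X (kernel_of R X Y f) W q"
    and ker: "kernel_of R X Y f = kernel_of R X W q" and qs: "R_surjective R X W q"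
    using quot kernel_equivalence[OF f]
    unfolding has_quotients_def effective_for_def descent_def R_surjective_def by blast
  have qa: "is_arrow (base R) X W q" using q by (simp add: quotient_arrow_of_def)
  have "le R X X (kernel_of R X Y f) (kernel_of R X Y f)"
    using f by (simp add: le_refl typing graph_rel)
  then obtain h where h: "is_arrow (base R) W Y h" and fh: "f = Comp (base R) X W Y h q"
    using q f unfolding quotient_arrow_of_def by blast
  have "is_iso (base R) W Y h"
    using bal bijective_factor[OF qa h qs] surj ker h unfolding balanced_doctrine_def fh by blast
  then obtain g where g: "is_arrow (base R) Y W g" "Comp (base R) Y W Y h g = Ident (base R) Y"
    using h unfolding is_iso_def by blast
  have "quotient_arrow R X W q"
    using q kernel_equivalence[OF f] unfolding quotient_arrow_def by blast
  then obtain k where k: "is_arrow (base R) W X k" "Ident (base R) W = Comp (base R) W X W q k"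
    using proj[of W] qa typing(1)[of W] unfolding R_projective_def by blast
  let ?s = "Comp (base R) Y W X k g"
  have "Comp (base R) Y X Y f ?s = Comp (base R) Y W Y h (Comp (base R) Y X W q ?s)"
    using qa h k(1) g(1) by (simp add: fh comp_assoc typing)
  also have "Comp (base R) Y X W q ?s = g"
    using qa k g(1) by (simp add: comp_assoc k(2)[symmetric] typing)
  finally have "Comp (base R) Y X Y f ?s = Ident (base R) Y" using g by simp
  then show ?thesis using k(1) g(1) unfolding splits_def by (auto simp: typing)
qed

lemma quotient_arrow_of_unique:
  assumes equiv: "R_equivalence R X \<rho>"
    and q: "quotient_arrow_of R X \<rho> W q" and q': "quotient_arrow_of R X \<rho> W' q'"
  shows "\<exists>i j. is_arrow (base R) W' W i \<and> is_arrow (base R) W W' j \<and>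
    q = Comp (base R) X W' W i q' \<and> Comp (base R) W W' W i j = Ident (base R) W"
proof -
  have qa: "is_arrow (base R) X W q" "le R X X \<rho> (kernel_of R X W q)"
    and qa': "is_arrow (base R) X W' q'" "le R X X \<rho> (kernel_of R X W' q')"
    using q q' by (simp_all add: quotient_arrow_of_def)
  obtain j where j: "is_arrow (base R) W W' j" "q' = Comp (base R) X W W' j q"
    using q qa' qa unfolding quotient_arrow_of_def by blast
  obtain i where i: "is_arrow (base R) W' W i" "q = Comp (base R) X W' W i q'"
    using q' qa' qa unfolding quotient_arrow_of_def by blast
  let ?ij = "Comp (base R) W W' W i j"
  have "q = Comp (base R) X W W ?ij q"
    using i j qa by (simp add: comp_assoc[symmetric] typing)
  moreover have "q = Comp (base R) X W W (Ident (base R) W) q"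
    using qa by (simp add: typing)
  moreover have "?ij \<in> Hom (base R) W W" "Ident (base R) W \<in> Hom (base R) W W"
    using i j by (simp_all add: typing)
  ultimately have "?ij = Ident (base R) W"
    using q qa unfolding quotient_arrow_of_def by blast
  with i j show ?thesis by blast
qed

end

section \<open>The Eilenberg--Moore doctrine\<close>

locale monad_on_doctrine = relational_doctrine R + RD_monad R T \<eta> \<mu>
  for R :: "('o, 'a, 'r) doctrine" and T :: "('o, 'a, 'r, 'o, 'a, 'r) one_arrow"
    and \<eta> \<mu> :: "'o \<Rightarrow> 'a"
begin

abbreviation E where "E \<equiv> EM_doctrine R T \<eta> \<mu>"
abbreviation algebra where "algebra \<equiv> EM_algebra (base R) (fun_part T) \<eta> \<mu>"

lemmas T_functor = RD_one_arrow.fun_part_functor[OF one_arrow]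
lemmas T_obj = functor_between.on_obj_obj[OF T_functor]
lemmas T_arr = functor_between.on_arr_arrow[OF T_functor]
lemmas T_ident = functor_between.on_arr_ident[OF T_functor]
lemmas T_comp = functor_between.on_arr_comp[OF T_functor]
lemmas T_rel = RD_one_arrow.rel_part_rel[OF one_arrow]
lemmas T_mono = RD_one_arrow.rel_part_mono[OF one_arrow]
lemmas T_reindex = RD_one_arrow.rel_part_natural[OF one_arrow]
lemmas T_rident = RD_one_arrow.rel_part_rident[OF one_arrow]
lemmas T_rcomp = RD_one_arrow.rel_part_rcomp[OF one_arrow]
lemmas T_rconv = RD_one_arrow.rel_part_rconv[OF one_arrow]

lemmas eta_arrow = natural_transformation.component_arrow[OF RD_two_arrow.natural[OF unit],
    simplified id_one_arrow_def, simplified]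
lemmas eta_natural = natural_transformation.naturality[OF RD_two_arrow.natural[OF unit],
    simplified id_one_arrow_def, simplified]
lemmas mu_arrow = natural_transformation.component_arrow[OF RD_two_arrow.natural[OF mult],
    simplified comp_one_arrow_def, simplified]
lemmas mu_natural = natural_transformation.naturality[OF RD_two_arrow.natural[OF mult],
    simplified comp_one_arrow_def, simplified]

lemmas T_typing = typing T_obj T_arr T_rel eta_arrow mu_arrow

lemma algebraD:
  assumes "algebra X a"
  shows "X \<in> Obj (base R)" "a \<in> Hom (base R) (ob T X) X"
    "Comp (base R) X (ob T X) X a (\<eta> X) = Ident (base R) X"
    "Comp (base R) (ob T (ob T X)) (ob T X) X a (\<mu> X) =
     Comp (base R) (ob T (ob T X)) (ob T X) X a (ar T (ob T X) X a)"
  using assms by (simp_all add: EM_algebra_def)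

text \<open>
  Membership of \<open>\<alpha>\<close> in the fibre over the algebras \<open>(X, a)\<close> and \<open>(Y, b)\<close>, transposed along the
  adjunction between direct image and reindexing. It says that the structure maps carry
  \<open>T \<alpha>\<close>-related elements to \<open>\<alpha>\<close>-related ones, that is, \<open>\<alpha>\<close> is a relational congruence.
\<close>

definition compatible where
  "compatible X a Y b \<alpha> \<longleftrightarrow>
    le R (ob T X) (ob T Y) (rel_part T X Y \<alpha>) (reindex R (ob T X) X (ob T Y) Y a b \<alpha>)"

lemma Obj_E: "(X, a) \<in> Obj (base E) \<longleftrightarrow> algebra X a"
  by (simp add: EM_doctrine_def EM_category_def)

lemma Hom_E: "f \<in> Hom (base E) (X, a) (Y, b) \<longleftrightarrow> f \<in> Hom (base R) X Y \<and>
  Comp (base R) (ob T X) X Y f a = Comp (base R) (ob T X) (ob T Y) Y b (ar T X Y f)"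
  by (simp add: EM_doctrine_def EM_category_def EM_hom_def)

lemma E_simps:
  "Ident (base E) (X, a) = Ident (base R) X"
  "Comp (base E) (X, a) (Y, b) (Z, c) = Comp (base R) X Y Z"
  "le E (X, a) (Y, b) = le R X Y"
  "reindex E (X, a) (Y, b) (Z, c) (V, d) = reindex R X Y Z V"
  "rident E (X, a) = rident R X"
  "rcomp E (X, a) (Y, b) (Z, c) = rcomp R X Y Z"
  "rconv E (X, a) (Y, b) = rconv R X Y"
  by (simp_all add: EM_doctrine_def EM_category_def)

lemma E_graph_simps:
  "graph_of E (X, a) (Y, b) f = graph_of R X Y f"
  "R_surjective E (X, a) (Y, b) f = R_surjective R X Y f"
  "R_injective E (X, a) (Y, b) f = R_injective R X Y f"
  by (simp_all add: graph_of_def R_surjective_def R_injective_def E_simps)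

lemma Fib_E:
  assumes "algebra X a" "algebra Y b"
  shows "\<alpha> \<in> Fib E (X, a) (Y, b) \<longleftrightarrow> \<alpha> \<in> Fib R X Y \<and> compatible X a Y b \<alpha>"
  using assms[THEN algebraD(1)] assms[THEN algebraD(2)]
    direct_image_le_iff[of "ob T X" X a "ob T Y" Y b "rel_part T X Y \<alpha>" \<alpha>]
  by (auto simp: EM_doctrine_def compatible_def T_typing)

text \<open>
  In the transposed form, closure of the fibres under each relational operation is an instance of the
  lax naturality of that operation.
\<close>

lemma compatible_rident:
  assumes "algebra X a" shows "compatible X a X a (rident R X)"
  using algebraD[OF assms] by (simp add: compatible_def T_rident rident_reindex T_typing)

lemma compatible_rconv:
  assumes "algebra X a" "algebra Y b" "is_rel R X Y \<alpha>" "compatible X a Y b \<alpha>"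
  shows "compatible Y b X a (rconv R X Y \<alpha>)"
  using rconv_mono[OF _ _ assms(4)[unfolded compatible_def]] assms(3)
    algebraD[OF assms(1)] algebraD[OF assms(2)]
  by (simp add: compatible_def T_rconv reindex_rconv T_typing)

lemma compatible_rcomp:
  assumes X: "algebra X a" and Y: "algebra Y b" and Z: "algebra Z c"
    and rels: "is_rel R X Y \<alpha>" "is_rel R Y Z \<beta>"
    and comp: "compatible X a Y b \<alpha>" "compatible Y b Z c \<beta>"
  shows "compatible X a Z c (rcomp R X Y Z \<alpha> \<beta>)"
proof -
  note algs = algebraD(1,2)[OF X] algebraD(1,2)[OF Y] algebraD(1,2)[OF Z]
  let ?m = "rcomp R (ob T X) (ob T Y) (ob T Z)
    (reindex R (ob T X) X (ob T Y) Y a b \<alpha>) (reindex R (ob T Y) Y (ob T Z) Z b c \<beta>)"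
  have "le R (ob T X) (ob T Z) (rel_part T X Z (rcomp R X Y Z \<alpha> \<beta>)) ?m"
    using algs rels comp
    by (simp add: T_rcomp compatible_def) (intro rcomp_mono; simp add: T_typing)
  moreover have "le R (ob T X) (ob T Z) ?m
      (reindex R (ob T X) X (ob T Z) Z a c (rcomp R X Y Z \<alpha> \<beta>))"
    using algs rels by (intro rcomp_reindex) (simp_all add: T_typing)
  ultimately show ?thesis
    unfolding compatible_def using algs rels
    by (rule_tac le_trans[of "ob T X" "ob T Z" _ ?m]) (simp_all add: T_typing)
qed

lemma compatible_reindex:
  assumes X: "algebra X a" and A: "algebra A a'" and Y: "algebra Y b" and B: "algebra B b'"
    and f: "f \<in> Hom (base E) (X, a) (A, a')" and g: "g \<in> Hom (base E) (Y, b) (B, b')"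
    and \<alpha>: "is_rel R A B \<alpha>" and comp: "compatible A a' B b' \<alpha>"
  shows "compatible X a Y b (reindex R X A Y B f g \<alpha>)"
proof -
  note algs = algebraD(1,2)[OF X] algebraD(1,2)[OF A] algebraD(1,2)[OF Y] algebraD(1,2)[OF B]
  note homs = f[unfolded Hom_E] g[unfolded Hom_E]
  have "le R (ob T X) (ob T Y)
    (reindex R (ob T X) (ob T A) (ob T Y) (ob T B) (ar T X A f) (ar T Y B g) (rel_part T A B \<alpha>))
    (reindex R (ob T X) (ob T A) (ob T Y) (ob T B) (ar T X A f) (ar T Y B g)
      (reindex R (ob T A) A (ob T B) B a' b' \<alpha>))"
    using algs homs \<alpha> comp by (intro reindex_mono) (simp_all add: T_typing compatible_def)
  then show ?thesis
    unfolding compatible_def using algs homs \<alpha>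
    by (simp add: T_reindex reindex_reindex T_typing)
qed

lemma base_E_category: "category (base E)"
proof (rule category.intro, unfold split_paired_all)
  fix X a assume "(X, a) \<in> Obj (base E)"
  then show "Ident (base E) (X, a) \<in> Hom (base E) (X, a) (X, a)"
    by (simp add: Obj_E Hom_E E_simps algebraD T_typing T_ident)
next
  fix X a Y b f Z c g
  assume f: "is_arrow (base E) (X, a) (Y, b) f" and g: "is_arrow (base E) (Y, b) (Z, c) g"
  then have algs: "algebra X a" "algebra Y b" "algebra Z c"
    and homs: "f \<in> Hom (base R) X Y" "g \<in> Hom (base R) Y Z"
    by (simp_all add: Obj_E Hom_E)
  note algs = algs[THEN algebraD(1)] algs[THEN algebraD(2)]
  have "Comp (base R) (ob T X) X Z (Comp (base R) X Y Z g f) a =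
      Comp (base R) (ob T X) Y Z g (Comp (base R) (ob T X) X Y f a)"
    using algs homs by (simp add: comp_assoc T_typing)
  also have "\<dots> = Comp (base R) (ob T X) (ob T Y) Z (Comp (base R) (ob T Y) Y Z g b) (ar T X Y f)"
    using algs homs f by (simp add: Hom_E comp_assoc T_typing)
  also have "\<dots> = Comp (base R) (ob T X) (ob T Z) Z c (ar T X Z (Comp (base R) X Y Z g f))"
    using algs homs g by (simp add: Hom_E T_comp comp_assoc T_typing)
  finally show "Comp (base E) (X, a) (Y, b) (Z, c) g f \<in> Hom (base E) (X, a) (Z, c)"
    using algs homs by (simp add: Hom_E E_simps T_typing)
qed (auto simp: Obj_E Hom_E E_simps algebraD typing comp_assoc)

lemma EM_doctrine_is_doctrine: "relational_doctrine E"
proof (rule relational_doctrine.intro[OF base_E_category], unfold split_paired_all)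
  fix X a Y b \<alpha> \<beta> \<gamma>
  assume rels: "is_rel E (X, a) (Y, b) \<alpha>" "is_rel E (X, a) (Y, b) \<beta>" "is_rel E (X, a) (Y, b) \<gamma>"
    and les: "le E (X, a) (Y, b) \<alpha> \<beta>" "le E (X, a) (Y, b) \<beta> \<gamma>"
  then show "le E (X, a) (Y, b) \<alpha> \<gamma>"
    using le_trans[of X Y \<alpha> \<beta> \<gamma>] algebraD(1)[of X a] algebraD(1)[of Y b]
    by (auto simp: Obj_E Fib_E E_simps)
next
  fix X a Y b \<alpha> \<beta>
  assume rels: "is_rel E (X, a) (Y, b) \<alpha>" "is_rel E (X, a) (Y, b) \<beta>"
    and les: "le E (X, a) (Y, b) \<alpha> \<beta>" "le E (X, a) (Y, b) \<beta> \<alpha>"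
  then show "\<alpha> = \<beta>"
    using le_antisym[of X Y \<alpha> \<beta>] algebraD(1)[of X a] algebraD(1)[of Y b]
    by (auto simp: Obj_E Fib_E E_simps)
qed (auto simp: Obj_E Fib_E Hom_E E_simps typing algebraD le_refl
  reindex_mono reindex_ident reindex_comp rident_reindex rcomp_mono rcomp_reindex
  rconv_mono rconv_reindex rcomp_assoc rcomp_rident_left rcomp_rident_right
  rconv_rcomp rconv_rident rconv_rconv
  intro: compatible_rident compatible_rconv compatible_rcomp compatible_reindex)

lemma E_extensional:
  assumes "extensional_doctrine R"
  shows "extensional_doctrine E"
  unfolding extensional_doctrine_def split_paired_All Obj_E Hom_E E_simps
  using assms[unfolded extensional_doctrine_def] algebraD(1) by blast

text \<open>
  Identities, composition, order and graphs of the Eilenberg--Moore doctrine are those of \<open>R\<close>, so a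
  bijective homomorphism \<open>f\<close> is bijective in \<open>R\<close>. Its section in the base is a two-sided inverse by
  injectivity, and the inverse of a homomorphism is again one.
\<close>

lemma E_balanced:
  assumes ext: "extensional_doctrine R"
    and surj_split: surjective_arrows_split
  shows "balanced_doctrine E"
  unfolding balanced_doctrine_def split_paired_All
proof (intro allI impI, elim conjE)
  fix X a Y b f
  assume algs: "(X, a) \<in> Obj (base E)" "(Y, b) \<in> Obj (base E)"
    and hom: "f \<in> Hom (base E) (X, a) (Y, b)" and bij: "R_bijective E (X, a) (Y, b) f"
  note objs = algs[unfolded Obj_E, THEN algebraD(1)] algs[unfolded Obj_E, THEN algebraD(2)]
  have f: "is_arrow (base R) X Y f" using hom objs by (simp add: Hom_E)
  have inj: "le R X X (kernel_of R X Y f) (rident R X)" and surj: "R_surjective R X Y f"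
    using bij by (simp_all add: R_bijective_def E_graph_simps E_simps R_injective_def)
  obtain s where s: "is_arrow (base R) Y X s" and fs: "Comp (base R) Y X Y f s = Ident (base R) Y"
    using surj_split surj f unfolding splits_def by blast
  have sf: "Comp (base R) X Y X s f = Ident (base R) X"
    using split_epi_factor[OF ext f s fs, of X "Ident (base R) X"] inj f s
    by (simp add: typing kernel_eq_reindex reindex_ident)
  have "Comp (base R) (ob T Y) Y X s b = Comp (base R) (ob T Y) Y X s
      (Comp (base R) (ob T Y) (ob T Y) Y b (ar T Y Y (Comp (base R) Y X Y f s)))"
    using objs f s fs by (simp add: T_ident T_typing)
  also have "\<dots> = Comp (base R) (ob T Y) Y X s
      (Comp (base R) (ob T Y) (ob T X) Y (Comp (base R) (ob T X) (ob T Y) Y b (ar T X Y f)) (ar T Y X s))"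
    using objs f s by (simp add: T_comp comp_assoc T_typing)
  also have "\<dots> = Comp (base R) (ob T Y) Y X s
      (Comp (base R) (ob T Y) (ob T X) Y (Comp (base R) (ob T X) X Y f a) (ar T Y X s))"
    using hom by (simp add: Hom_E)
  also have "\<dots> = Comp (base R) (ob T Y) (ob T X) X
      (Comp (base R) (ob T X) X X (Comp (base R) X Y X s f) a) (ar T Y X s)"
    using objs f s by (simp add: comp_assoc T_typing)
  also have "\<dots> = Comp (base R) (ob T Y) (ob T X) X a (ar T Y X s)"
    using objs f s by (simp add: sf T_typing)
  finally have "s \<in> Hom (base E) (Y, b) (X, a)"
    using s by (simp add: Hom_E)
  with fs sf show "is_iso (base E) (X, a) (Y, b) f"
    unfolding is_iso_def by (auto simp: E_simps)
qed

section \<open>Quotients of algebras\<close>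

text \<open>
  Homomorphism equations can be checked after composing with \<open>T q\<close>, which is split by \<open>T s\<close>.
\<close>

lemma hom_descends:
  assumes X: "algebra X a" and W: "algebra W w" and Z: "algebra Z c"
    and q: "q \<in> Hom (base E) (X, a) (W, w)"
    and s: "is_arrow (base R) W X s" and sec: "Comp (base R) W X W q s = Ident (base R) W"
    and h: "h \<in> Hom (base R) W Z"
    and hq: "Comp (base R) X W Z h q \<in> Hom (base E) (X, a) (Z, c)"
  shows "h \<in> Hom (base E) (W, w) (Z, c)"
proof -
  note objs = algebraD(1,2)[OF X] algebraD(1,2)[OF W] algebraD(1,2)[OF Z]
  note qh = q[unfolded Hom_E] and hqh = hq[unfolded Hom_E]
  have Tsec: "Comp (base R) (ob T W) (ob T X) (ob T W) (ar T X W q) (ar T W X s) = Ident (base R) (ob T W)"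
    using objs qh s sec T_comp[of W X s W q] by (simp add: T_ident)
  have "Comp (base R) (ob T X) (ob T W) Z (Comp (base R) (ob T W) W Z h w) (ar T X W q) =
      Comp (base R) (ob T X) X Z (Comp (base R) X W Z h q) a"
    using objs qh h by (simp add: comp_assoc[symmetric] T_typing)
  also have "\<dots> = Comp (base R) (ob T X) (ob T W) Z
      (Comp (base R) (ob T W) (ob T Z) Z c (ar T W Z h)) (ar T X W q)"
    using objs qh hqh h by (simp add: comp_assoc[symmetric] T_comp T_typing)
  finally have eq: "Comp (base R) (ob T X) (ob T W) Z (Comp (base R) (ob T W) W Z h w) (ar T X W q) =
      Comp (base R) (ob T X) (ob T W) Z (Comp (base R) (ob T W) (ob T Z) Z c (ar T W Z h)) (ar T X W q)" .
  have "Comp (base R) (ob T W) W Z h w = Comp (base R) (ob T W) (ob T Z) Z c (ar T W Z h)"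
    by (rule category.split_epi_cancel[OF base_category _ _ Tsec _ _ eq])
      (use objs qh s h in \<open>simp_all add: T_typing\<close>)
  with h show ?thesis by (simp add: Hom_E)
qed

text \<open>
  A map \<open>w\<close> making \<open>q\<close> commute with the structures inherits the algebra laws from \<open>a\<close>: the unit
  law is checked after \<open>q\<close> and the associativity law after \<open>T (T q)\<close>, both of which are split.
\<close>

lemma algebra_descends:
  assumes X: "algebra X a" and W: "W \<in> Obj (base R)" and w: "w \<in> Hom (base R) (ob T W) W"
    and q: "is_arrow (base R) X W q"
    and s: "is_arrow (base R) W X s" and sec: "Comp (base R) W X W q s = Ident (base R) W"
    and wq: "Comp (base R) (ob T X) (ob T W) W w (ar T X W q) = Comp (base R) (ob T X) X W q a"
  shows "algebra W w"
proof -
  note objs = algebraD(1,2)[OF X] W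
  let ?TTX = "ob T (ob T X)" and ?TTW = "ob T (ob T W)"
  let ?Tq = "ar T X W q" let ?TTq = "ar T (ob T X) (ob T W) ?Tq"
  have "Comp (base R) X W W (Comp (base R) W (ob T W) W w (\<eta> W)) q =
      Comp (base R) X (ob T W) W w (Comp (base R) X (ob T X) (ob T W) ?Tq (\<eta> X))"
    using objs w q by (simp add: comp_assoc[symmetric] eta_natural T_typing)
  also have "\<dots> = Comp (base R) X X W q (Comp (base R) X (ob T X) X a (\<eta> X))"
    using objs w q by (simp add: comp_assoc wq T_typing)
  also have "\<dots> = Comp (base R) X W W (Ident (base R) W) q"
    using objs q by (simp add: algebraD(3)[OF X] typing)
  finally have unit_q: "Comp (base R) X W W (Comp (base R) W (ob T W) W w (\<eta> W)) q =
      Comp (base R) X W W (Ident (base R) W) q" .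
  have unit_law: "Comp (base R) W (ob T W) W w (\<eta> W) = Ident (base R) W"
    by (rule category.split_epi_cancel[OF base_category q s sec _ _ unit_q])
      (use objs w in \<open>simp_all add: T_typing\<close>)
  have "Comp (base R) ?TTW ?TTX ?TTW ?TTq (ar T (ob T W) (ob T X) (ar T W X s)) =
      ar T (ob T W) (ob T W) (ar T W W (Comp (base R) W X W q s))"
    using objs q s by (simp add: T_comp T_typing)
  then have TTsec: "Comp (base R) ?TTW ?TTX ?TTW ?TTq (ar T (ob T W) (ob T X) (ar T W X s)) = Ident (base R) ?TTW"
    using objs by (simp add: sec T_ident T_typing)
  have "Comp (base R) ?TTX ?TTW W (Comp (base R) ?TTW (ob T W) W w (\<mu> W)) ?TTq =
      Comp (base R) ?TTX (ob T W) W w (Comp (base R) ?TTX (ob T X) (ob T W) ?Tq (\<mu> X))"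
    using objs w q by (simp add: comp_assoc[symmetric] mu_natural T_typing)
  also have "\<dots> = Comp (base R) ?TTX X W q (Comp (base R) ?TTX (ob T X) X a (\<mu> X))"
    using objs w q by (simp add: comp_assoc wq T_typing)
  also have "\<dots> = Comp (base R) ?TTX (ob T X) W (Comp (base R) (ob T X) (ob T W) W w ?Tq) (ar T (ob T X) X a)"
    using objs q by (simp add: algebraD(4)[OF X] wq comp_assoc T_typing)
  also have "\<dots> = Comp (base R) ?TTX (ob T W) W w (ar T (ob T X) W (Comp (base R) (ob T X) X W q a))"
    using objs w q by (simp add: comp_assoc T_comp T_typing)
  also have "\<dots> = Comp (base R) ?TTX ?TTW W (Comp (base R) ?TTW (ob T W) W w (ar T (ob T W) W w)) ?TTq"
    using objs w q by (simp add: wq[symmetric] comp_assoc T_comp T_typing)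
  finally have mult_q: "Comp (base R) ?TTX ?TTW W (Comp (base R) ?TTW (ob T W) W w (\<mu> W)) ?TTq =
      Comp (base R) ?TTX ?TTW W (Comp (base R) ?TTW (ob T W) W w (ar T (ob T W) W w)) ?TTq" .
  have "Comp (base R) ?TTW (ob T W) W w (\<mu> W) = Comp (base R) ?TTW (ob T W) W w (ar T (ob T W) W w)"
    by (rule category.split_epi_cancel[OF base_category _ _ TTsec _ _ mult_q])
      (use objs w q s in \<open>simp_all add: T_typing\<close>)
  with unit_law show ?thesis using W w by (simp add: EM_algebra_def)
qed

text \<open>
  The factorisation through \<open>q\<close> exists in the base by means of the section and is a homomorphism
  by descent. This serves both for quotients of congruences and for the presentation of an algebra by
  the free algebra on its carrier.
\<close>

lemma split_epi_quotient:
  assumes ext: "extensional_doctrine R"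
    and X: "algebra X a" and W: "algebra W w"
    and q: "q \<in> Hom (base E) (X, a) (W, w)"
    and s: "is_arrow (base R) W X s" and sec: "Comp (base R) W X W q s = Ident (base R) W"
  shows "quotient_arrow_of E (X, a) (kernel_of R X W q) (W, w) q"
  unfolding quotient_arrow_of_def split_paired_All
proof (intro conjI allI impI; (elim conjE)?)
  note objs = algebraD(1)[OF X] algebraD(1)[OF W]
  have qa: "is_arrow (base R) X W q" using q objs by (simp add: Hom_E)
  show "(X, a) \<in> Obj (base E)" "(W, w) \<in> Obj (base E)" using X W by (simp_all add: Obj_E)
  show "le E (X, a) (X, a) (kernel_of R X W q) (kernel_of E (X, a) (W, w) q)"
    using qa by (simp add: E_simps E_graph_simps le_refl typing graph_rel)
  show "q \<in> Hom (base E) (X, a) (W, w)" by (rule q)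
  fix Z c f
  assume Zc: "(Z, c) \<in> Obj (base E)" and f: "f \<in> Hom (base E) (X, a) (Z, c)"
    and ker: "le E (X, a) (X, a) (kernel_of R X W q) (kernel_of E (X, a) (Z, c) f)"
  have Z: "algebra Z c" using Zc by (simp add: Obj_E)
  have fa: "is_arrow (base R) X Z f" using f objs algebraD(1)[OF Z] by (simp add: Hom_E)
  let ?h = "Comp (base R) W X Z f s"
  have fac: "Comp (base R) X W Z ?h q = f"
    using split_epi_factor[OF ext qa s sec fa] ker by (simp add: E_simps E_graph_simps)
  have "?h \<in> Hom (base R) W Z" using s fa by (simp add: typing)
  then have "?h \<in> Hom (base E) (W, w) (Z, c)"
    using hom_descends[OF X W Z q s sec] fac f by simp
  moreover have "h = ?h"
    if "h \<in> Hom (base E) (W, w) (Z, c)" "f = Comp (base E) (X, a) (W, w) (Z, c) h q" for h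
  proof (rule category.split_epi_cancel[OF base_category qa s sec])
    show "Comp (base R) X W Z h q = Comp (base R) X W Z ?h q"
      unfolding fac using that(2) by (simp add: E_simps)
  qed (use that(1) fa s in \<open>simp_all add: Hom_E typing\<close>)
  ultimately show "\<exists>!h. h \<in> Hom (base E) (W, w) (Z, c) \<and> f = Comp (base E) (X, a) (W, w) (Z, c) h q"
    using fac by (intro ex1I[of _ ?h]) (simp_all add: E_simps)
qed

text \<open>
  On elements, \<open>w\<close> applies \<open>a\<close> to representatives chosen by \<open>s\<close>. The choice does not matter:
  \<open>s \<circ> q\<close> is related to the identity by the kernel of \<open>q\<close>, preservation of relations by \<open>T\<close> relates
  \<open>T (s \<circ> q)\<close> to the identity by \<open>T\<close> of the kernel, and compatibility brings this back along \<open>a\<close>.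
  Hence \<open>q \<circ> a \<circ> T (s \<circ> q) = q \<circ> a\<close>, so that \<open>w \<circ> T q = q \<circ> a\<close>.
\<close>

lemma algebra_on_quotient:
  assumes ext: "extensional_doctrine R"
    and X: "algebra X a" and q: "is_arrow (base R) X W q"
    and s: "is_arrow (base R) W X s" and sec: "Comp (base R) W X W q s = Ident (base R) W"
    and comp: "compatible X a X a (kernel_of R X W q)"
  defines "w \<equiv> Comp (base R) (ob T W) X W q (Comp (base R) (ob T W) (ob T X) X a (ar T W X s))"
  shows "algebra W w" and "q \<in> Hom (base E) (X, a) (W, w)"
proof -
  note objs = algebraD(1,2)[OF X]
  let ?C = "Comp (base R)" and ?TX = "ob T X" and ?I = "Ident (base R) X"
  let ?k = "kernel_of R X W q"
  let ?sq = "?C X W X s q" let ?Tsq = "ar T X X ?sq"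
  have k: "is_rel R X X ?k" and sq: "is_arrow (base R) X X ?sq"
    using q s by (simp_all add: typing graph_rel)
  have "le R ?TX ?TX (rident R ?TX) (rel_part T X X (reindex R X X X X ?sq ?I ?k))"
    using T_mono[OF _ _ section_kernel[OF q s sec]] objs k sq by (simp add: T_rident T_typing)
  also have "rel_part T X X (reindex R X X X X ?sq ?I ?k) =
      reindex R ?TX ?TX ?TX ?TX ?Tsq (Ident (base R) ?TX) (rel_part T X X ?k)"
    using objs k sq by (simp add: T_reindex T_ident T_typing)
  finally have 1: "le R ?TX ?TX (rident R ?TX)
      (reindex R ?TX ?TX ?TX ?TX ?Tsq (Ident (base R) ?TX) (rel_part T X X ?k))" (is "le R _ _ _ ?m") .
  have "le R ?TX ?TX ?m (reindex R ?TX ?TX ?TX ?TX ?Tsq (Ident (base R) ?TX) (reindex R ?TX X ?TX X a a ?k))"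
    using comp objs k sq by (intro reindex_mono) (simp_all add: compatible_def T_typing)
  also have "reindex R ?TX ?TX ?TX ?TX ?Tsq (Ident (base R) ?TX) (reindex R ?TX X ?TX X a a ?k) =
      reindex R ?TX X ?TX X (?C ?TX ?TX X a ?Tsq) a ?k"
    using objs k sq by (simp add: reindex_reindex T_typing)
  finally have "le R ?TX ?TX (rident R ?TX) (reindex R ?TX X ?TX X (?C ?TX ?TX X a ?Tsq) a ?k)"
    using 1 objs k sq by (rule_tac le_trans[of ?TX ?TX _ ?m]) (simp_all add: T_typing)
  then have cong: "?C ?TX X W q (?C ?TX ?TX X a ?Tsq) = ?C ?TX X W q a"
    using arrows_identify_through[OF ext, of ?TX X "?C ?TX ?TX X a ?Tsq" a W q ?k] objs k sq q
    by (simp add: T_typing le_refl)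
  have w: "w \<in> Hom (base R) (ob T W) W"
    using objs q s by (simp add: w_def T_typing)
  have wq: "?C ?TX (ob T W) W w (ar T X W q) = ?C ?TX X W q a"
    using objs q s cong by (simp add: w_def comp_assoc[symmetric] T_comp T_typing)
  show "algebra W w"
    using algebra_descends[OF X _ w q s sec wq] q by simp
  show "q \<in> Hom (base E) (X, a) (W, w)"
    using q wq by (simp add: Hom_E)
qed

end

context monad_on_doctrine
begin

text \<open>
  The quotient is computed in \<open>R\<close>; being descent, it is surjective there and hence has a section in
  the base.
\<close>

lemma E_quotient:
  assumes ext: "extensional_doctrine R" and quot: "has_quotients R"
    and surj_split: surjective_arrows_split
    and \<rho>: "R_equivalence E (X, a) \<rho>"
  obtains W w q s where "algebra W w" "q \<in> Hom (base E) (X, a) (W, w)"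
    "is_arrow (base R) W X s" "Comp (base R) W X W q s = Ident (base R) W"
    "\<rho> = kernel_of R X W q" "R_surjective R X W q"
    "quotient_arrow_of E (X, a) \<rho> (W, w) q"
proof -
  have X: "algebra X a" using \<rho> by (simp add: R_equivalence_def Obj_E)
  then have comp: "compatible X a X a \<rho>" and "R_equivalence R X \<rho>"
    using \<rho> algebraD(1)[OF X] by (simp_all add: R_equivalence_def Fib_E E_simps)
  then obtain W q where q: "is_arrow (base R) X W q" and ker: "\<rho> = kernel_of R X W q"
    and surj: "R_surjective R X W q"
    using quot
    unfolding has_quotients_def quotient_arrow_of_def effective_for_def descent_def R_surjective_def
    by blast
  obtain s where s: "is_arrow (base R) W X s" and sec: "Comp (base R) W X W q s = Ident (base R) W"
    using surj_split surj q unfolding splits_def by blast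
  obtain w where w: "algebra W w" "q \<in> Hom (base E) (X, a) (W, w)"
    using algebra_on_quotient[OF ext X q s sec] comp ker by blast
  show thesis
    using that[OF w s sec ker surj] split_epi_quotient[OF ext X w s sec] ker by simp
qed

lemma E_has_quotients:
  assumes ext: "extensional_doctrine R" and quot: "has_quotients R"
    and surj_split: surjective_arrows_split
  shows "has_quotients E"
  unfolding has_quotients_def split_paired_All
proof (intro allI impI)
  fix X a \<rho>
  assume \<rho>: "R_equivalence E (X, a) \<rho>"
  obtain W w q s where "\<rho> = kernel_of R X W q" "R_surjective R X W q"
    "quotient_arrow_of E (X, a) \<rho> (W, w) q"
    by (rule E_quotient[OF ext quot surj_split \<rho>])
  then show "\<exists>V p. quotient_arrow_of E (X, a) \<rho> V p \<and> effective_for E (X, a) \<rho> V p \<and> descent E (X, a) V p"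
    by (intro exI[of _ "(W, w)"] exI[of _ q])
      (simp add: effective_for_def descent_def E_simps E_graph_simps R_surjective_def)
qed

text \<open>
  An arbitrary quotient arrow need not come with an effective descent witness of its own, but it
  agrees up to an isomorphism with the quotient constructed above for the same equivalence relation,
  and that one splits in the base.
\<close>

lemma E_quotient_arrow_splits:
  assumes ext: "extensional_doctrine R" and quot: "has_quotients R"
    and surj_split: surjective_arrows_split
    and p: "quotient_arrow E (X, a) (Y, b) p"
  shows "splits (base R) X Y p"
proof -
  obtain \<rho> where \<rho>: "R_equivalence E (X, a) \<rho>" and p\<rho>: "quotient_arrow_of E (X, a) \<rho> (Y, b) p"
    using p unfolding quotient_arrow_def by blast
  obtain W w q s where W: "algebra W w" and q: "q \<in> Hom (base E) (X, a) (W, w)"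
    and s: "is_arrow (base R) W X s" "Comp (base R) W X W q s = Ident (base R) W"
    and q\<rho>: "quotient_arrow_of E (X, a) \<rho> (W, w) q"
    by (rule E_quotient[OF ext quot surj_split \<rho>])
  \<comment> \<open>The mutual factorisations of \<open>p\<close> and \<open>q\<close>; since \<open>i \<circ> j = id\<close>, the section \<open>s\<close> of \<open>q\<close> gives
    the section \<open>s \<circ> j\<close> of \<open>p\<close>.\<close>
  obtain i j where ij: "i \<in> Hom (base R) W Y" "is_arrow (base R) Y W j" "p = Comp (base R) X W Y i q"
    "Comp (base R) Y W Y i j = Ident (base R) Y"
    using relational_doctrine.quotient_arrow_of_unique[OF EM_doctrine_is_doctrine \<rho> p\<rho> q\<rho>]
    by (auto simp: Obj_E Hom_E E_simps EM_algebra_def)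
  have qa: "is_arrow (base R) X W q" using q s by (simp add: Hom_E)
  let ?t = "Comp (base R) Y W X s j"
  have "Comp (base R) Y X Y p ?t = Comp (base R) Y W Y i (Comp (base R) Y W W (Comp (base R) W X W q s) j)"
    unfolding ij(3) using qa s(1) ij(1,2) by (simp add: comp_assoc typing)
  also have "\<dots> = Ident (base R) Y" using s ij by (simp add: typing)
  finally show ?thesis unfolding splits_def using s(1) ij(2) by (auto simp: typing)
qed

section \<open>Projectivity of free algebras\<close>

lemma free_algebra: "X \<in> Obj (base R) \<Longrightarrow> algebra (ob T X) (\<mu> X)"
  using mult_unit_left[of X] mult_assoc[of X] by (simp add: EM_algebra_def T_typing)

text \<open>
  Lift the transpose \<open>f \<circ> \<eta>\<^sub>P\<close> of \<open>f\<close> along a section \<open>s\<close> of \<open>q\<close> in the base and transpose back: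
  passing to the transpose moves the lifting problem to the base, where \<open>q\<close> splits.
\<close>

lemma free_algebra_projective:
  assumes ext: "extensional_doctrine R" and quot: "has_quotients R"
    and surj_split: surjective_arrows_split
    and P: "P \<in> Obj (base R)"
  shows "R_projective E (ob T P, \<mu> P)"
  unfolding R_projective_def split_paired_All
proof (intro conjI allI impI, goal_cases)
  case 1
  show ?case using free_algebra[OF P] by (simp add: Obj_E)
next
  case (2 X a Y b f q)
  let ?C = "Comp (base R)" and ?TP = "ob T P" and ?TX = "ob T X" and ?TY = "ob T Y"
  have X: "algebra X a" and Y: "algebra Y b" and f: "f \<in> Hom (base E) (?TP, \<mu> P) (Y, b)"
    and qq: "quotient_arrow E (X, a) (Y, b) q" and q: "q \<in> Hom (base E) (X, a) (Y, b)"
    using 2 by (auto simp: quotient_arrow_def quotient_arrow_of_def Obj_E)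
  note objs = algebraD(1,2)[OF X] algebraD(1,2)[OF Y] P
  note fh = f[unfolded Hom_E] and qh = q[unfolded Hom_E]
  obtain s where s: "s \<in> Hom (base R) Y X" "?C Y X Y q s = Ident (base R) Y"
    using E_quotient_arrow_splits[OF ext quot surj_split qq] unfolding splits_def by blast
  define g where "g = ?C P Y X s (?C P ?TP Y f (\<eta> P))"
  have g: "g \<in> Hom (base R) P X" using objs fh s by (simp add: g_def T_typing)
  have qg: "?C P X Y q g = ?C P ?TP Y f (\<eta> P)"
    using objs fh qh s by (simp add: g_def comp_assoc T_typing)
  let ?h = "?C ?TP ?TX X a (ar T P X g)"
  have "?C ?TP X Y q ?h = ?C ?TP ?TX Y (?C ?TX X Y q a) (ar T P X g)"
    using objs g qh by (simp add: comp_assoc T_typing)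
  also have "\<dots> = ?C ?TP ?TY Y b (ar T P Y (?C P X Y q g))"
    using objs g qh by (simp add: comp_assoc T_comp T_typing)
  also have "\<dots> = ?C ?TP (ob T ?TP) Y (?C (ob T ?TP) ?TY Y b (ar T ?TP Y f)) (ar T P ?TP (\<eta> P))"
    using objs fh by (simp add: qg comp_assoc T_comp T_typing)
  also have "\<dots> = ?C ?TP (ob T ?TP) Y (?C (ob T ?TP) ?TP Y f (\<mu> P)) (ar T P ?TP (\<eta> P))"
    using fh by simp
  also have "\<dots> = f"
    using objs fh[THEN conjunct1] by (simp add: comp_assoc[symmetric] mult_unit_right T_typing)
  finally have fac: "f = ?C ?TP X Y q ?h" by simp
  have "?C (ob T ?TP) ?TP X ?h (\<mu> P) = ?C (ob T ?TP) ?TX X a (?C (ob T ?TP) ?TP ?TX (ar T P X g) (\<mu> P))"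
    using objs g by (simp add: comp_assoc T_typing)
  also have "\<dots> = ?C (ob T ?TP) (ob T ?TX) X (?C (ob T ?TX) ?TX X a (\<mu> X)) (ar T ?TP ?TX (ar T P X g))"
    using objs g mu_natural[of P X g] by (simp add: comp_assoc[symmetric] T_typing)
  also have "\<dots> = ?C (ob T ?TP) ?TX X a (ar T ?TP X ?h)"
    using objs g by (simp add: algebraD(4)[OF X] comp_assoc T_comp T_typing)
  finally have "?h \<in> Hom (base E) (?TP, \<mu> P) (X, a)"
    using objs g by (simp add: Hom_E T_typing)
  with fac show ?case by (auto simp: E_simps)
qed

text \<open>
  The structure map is a homomorphism from the free algebra and is split in the base by \<open>\<eta>\<^sub>X\<close>.
\<close>

lemma algebra_structure_quotient:
  assumes ext: "extensional_doctrine R" and X: "algebra X a"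
  shows "quotient_arrow E (ob T X, \<mu> X) (X, a) a"
proof -
  note objs = algebraD(1,2)[OF X] free_algebra[OF algebraD(1)[OF X]]
  have a: "a \<in> Hom (base E) (ob T X, \<mu> X) (X, a)"
    using objs algebraD(4)[OF X] by (simp add: Hom_E)
  have "quotient_arrow_of E (ob T X, \<mu> X) (kernel_of R (ob T X) X a) (X, a) a"
    using split_epi_quotient[OF ext objs(3) X a _ algebraD(3)[OF X]] objs by (simp add: T_typing)
  moreover have "R_equivalence E (ob T X, \<mu> X) (kernel_of R (ob T X) X a)"
    using relational_doctrine.kernel_equivalence[OF EM_doctrine_is_doctrine, of "(ob T X, \<mu> X)" "(X, a)" a]
      a X objs(3) by (simp add: Obj_E E_simps E_graph_simps)
  ultimately show ?thesis unfolding quotient_arrow_def by blast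
qed

lemma free_algebras_projective_cover:
  assumes ext: "extensional_doctrine R" and quot: "has_quotients R"
    and surj_split: surjective_arrows_split
  shows "R_projective_cover E (free_algebras (base R) (fun_part T) \<mu>)"
  unfolding R_projective_cover_def
proof (intro conjI ballI)
  show "free_algebras (base R) (fun_part T) \<mu> \<subseteq> Obj (base E)"
    by (auto simp: free_algebras_def Obj_E free_algebra)
  show "R_projective E P" if "P \<in> free_algebras (base R) (fun_part T) \<mu>" for P
    using that free_algebra_projective[OF ext quot surj_split] by (auto simp: free_algebras_def)
  fix A assume "A \<in> Obj (base E)"
  then obtain X a where A: "A = (X, a)" and X: "algebra X a" by (cases A) (simp add: Obj_E)
  show "\<exists>P\<in>free_algebras (base R) (fun_part T) \<mu>. \<exists>q. quotient_arrow E P A q"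
    using algebra_structure_quotient[OF ext X] algebraD(1)[OF X]
    unfolding A free_algebras_def by blast
qed

end

section \<open>The identity monad and the equivalence\<close>

lemma id_one_arrow_simps: "ob id_one_arrow X = X" "ar id_one_arrow X Y f = f"
  by (simp_all add: id_one_arrow_def)

lemma (in relational_doctrine) identity_monad:
  "RD_monad R id_one_arrow (Ident (base R)) (Ident (base R))"
proof -
  have "RD_one_arrow R R id_one_arrow"
    by unfold_locales (simp_all add: id_one_arrow_def rcomp_rel)
  moreover have two: "RD_two_arrow R R id_one_arrow id_one_arrow (Ident (base R))"
    by unfold_locales (simp_all add: id_one_arrow_def typing le_refl reindex_ident)
  moreover have "comp_one_arrow id_one_arrow id_one_arrow =
      (id_one_arrow :: ('o, 'a, 'r, 'o, 'a, 'r) one_arrow)"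
    by (simp add: comp_one_arrow_def id_one_arrow_def)
  ultimately show ?thesis
    by (intro RD_monad.intro) (simp_all add: id_one_arrow_simps typing)
qed

theorem theorem6p13:
  fixes R :: "('o, 'a, 'r) doctrine"
  assumes "relational_doctrine R" and "extensional_doctrine R" and "has_quotients R"
  shows "(\<forall>X Y f. is_arrow (base R) X Y f \<and> R_surjective R X Y f \<longrightarrow> splits (base R) X Y f)
    \<longleftrightarrow>
    (\<forall>T \<eta> \<mu>. RD_monad R T \<eta> \<mu> \<longrightarrow>
      relational_doctrine (EM_doctrine R T \<eta> \<mu>) \<and>
      balanced_doctrine (EM_doctrine R T \<eta> \<mu>) \<and>
      extensional_doctrine (EM_doctrine R T \<eta> \<mu>) \<and>
      has_quotients (EM_doctrine R T \<eta> \<mu>) \<and>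
      R_projective_cover (EM_doctrine R T \<eta> \<mu>) (free_algebras (base R) (fun_part T) \<mu>))"
    (is "?split \<longleftrightarrow> ?EM")
proof
  assume split: ?split
  show ?EM
  proof (intro allI impI)
    fix T \<eta> \<mu> assume "RD_monad R T \<eta> \<mu>"
    then interpret monad_on_doctrine R T \<eta> \<mu>
      using assms(1) by (simp add: monad_on_doctrine_def)
    show "relational_doctrine E \<and> balanced_doctrine E \<and> extensional_doctrine E \<and>
        has_quotients E \<and> R_projective_cover E (free_algebras (base R) (fun_part T) \<mu>)"
      using EM_doctrine_is_doctrine E_balanced[OF assms(2) split] E_extensional[OF assms(2)]
        E_has_quotients[OF assms(2,3) split] free_algebras_projective_cover[OF assms(2,3) split]
      by blast
  qed
next
  assume EM: ?EM
  interpret relational_doctrine R by (rule assms(1))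
  \<comment> \<open>The identity monad has only the algebras \<open>(X, id)\<close>, all of them free, so the
    cover condition makes every object projective.\<close>
  interpret id: monad_on_doctrine R id_one_arrow "Ident (base R)" "Ident (base R)"
    by (simp add: monad_on_doctrine_def identity_monad assms(1))
  let ?Id = "id_one_arrow :: ('o, 'a, 'r, 'o, 'a, 'r) one_arrow"
  have props: "balanced_doctrine id.E" "has_quotients id.E"
    "R_projective_cover id.E (free_algebras (base R) (fun_part ?Id) (Ident (base R)))"
    using EM[rule_format, OF identity_monad] by simp_all
  have "P \<in> free_algebras (base R) (fun_part ?Id) (Ident (base R))"
    if "P \<in> Obj (base id.E)" for P
    using that by (cases P)
      (auto simp: id.Obj_E EM_algebra_def free_algebras_def id_one_arrow_simps typing)
  then have proj: "R_projective id.E P" if "P \<in> Obj (base id.E)" for P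
    using that props(3) unfolding R_projective_cover_def by blast
  show ?split
  proof (intro allI impI, elim conjE)
    fix X Y f
    assume f: "X \<in> Obj (base R)" "Y \<in> Obj (base R)" "f \<in> Hom (base R) X Y"
      and surj: "R_surjective R X Y f"
    let ?X = "(X, Ident (base R) X)" and ?Y = "(Y, Ident (base R) Y)"
    have fE: "is_arrow (base id.E) ?X ?Y f"
      using f by (simp add: id.Obj_E id.Hom_E EM_algebra_def id_one_arrow_simps typing)
    have "splits (base id.E) ?X ?Y f"
      using relational_doctrine.surjective_splits_if_all_projective[OF id.EM_doctrine_is_doctrine
          props(1,2) proj fE] surj by (simp add: id.E_graph_simps)
    then show "splits (base R) X Y f"
      by (auto simp: splits_def id.Hom_E id.E_simps)
  qed
qed

end
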